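(* Let $T$ be a rooted directed tree and let $O$ consist of the leaves of $T$. Then $I_{T,O}$ is generated by the quadratic tetrad constraints $$\sigma_{ik}\sigma_{jl}-\sigma_{il}\sigma_{kj}$$ such that $i,j,k,l\in O$ and there is a choke point $c$ between $\{i,j\}$ and $\{k,l\}$ in $T$.
   Context: A rooted directed tree is a directed graph whose underlying undirected graph is a tree, with all edges directed away from a given root vertex. For a directed acyclic graph $G$ (vertices numbered so that $i\to j\in E(G)$ only if $i<j$), a collider is a pair of edges $i\to k$, $j\to k$ with the same head. For vertices $i,j$, $T(i,j)$ denotes the set of treks from $i$ to $j$: simple paths $P$ in (the underlying undirected graph of) $G$ from $i$ to $j$ containing no collider. Each trek goes from $i$ up to a topmost vertex $\mathrm{top}(P)$ and then down to $j$; $T(i,i)$ consists of the single empty trek, with top $i$. Let $\mathbb{C}[\Sigma]$ be the polynomial ring in $\sigma_{ij}=\sigma_{ji}$, $i,j\in V(G)$, and $\phi_G:\mathbb{C}[\Sigma]\to\mathbb{C}[a_i,\lambda_{ij}\mid i\in V(G),\ i\to j\in E(G)]$ the ring homomorphism $\sigma_{ij}\mapsto\sum_{P\in T(i,j)}a_{\mathrm{top}(P)}\prod_{k\to l\in P}\lambda_{kl}$. Set $I_G=\ker\phi_G$, and for $O\subseteq V(G)$ set $I_{G,O}=I_G\cap\mathbb{C}[\sigma_{ij}\mid i,j\in O]$, an ideal of $\mathbb{C}[\sigma_{ij}\mid i,j\in O]$. A vertex $c$ is a choke point between vertex sets $I$ and $J$ if every trek from a vertex of $I$ to a vertex of $J$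 contains $c$ and either (1) $c$ is on the $I$-side of every trek from $I$ to $J$, or (2) $c$ is on the $J$-side of every trek from $I$ to $J$. Here, for a trek from $i\in I$ to $j\in J$ with top $t$, the $I$-side is the directed part from $t$ to $i$ and the $J$-side is the directed part from $t$ to $j$, both including $t$. *)

theory Defs
  imports
    Complex_Main
    "HOL-Library.Poly_Mapping"
    "HOL-Library.Uprod"
    "Graph_Theory.Digraph_Component"
    "Graph_Theory.Vertex_Walk"
    "HOL-Algebra.RingHom"
begin

section \<open>Polynomials over the complex numbers\<close>

text \<open>A polynomial is a finitely supported map from monomials to coefficients, and a monomial
  is a finitely supported exponent vector; multiplication is the convolution product of
  \<^theory>\<open>HOL-Library.Poly_Mapping\<close>.\<close>

type_synonym 'x cpoly = "('x \<Rightarrow>\<^sub>0 nat) \<Rightarrow>\<^sub>0 complex"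

definition Var :: "'x \<Rightarrow> 'x cpoly" where
  "Var x = Poly_Mapping.single (Poly_Mapping.single x 1) 1"

definition Const :: "complex \<Rightarrow> 'x cpoly" where
  "Const a = Poly_Mapping.single 0 a"

text \<open>The polynomial ring \<open>\<complex>[X]\<close> on a set \<open>X\<close> of variables.\<close>

definition poly_ring :: "'x set \<Rightarrow> 'x cpoly ring" where
  "poly_ring X = \<lparr>carrier = {p. \<forall>m\<in>Poly_Mapping.keys p. Poly_Mapping.keys m \<subseteq> X},
     mult = (*), one = 1, zero = 0, add = (+)\<rparr>"

text \<open>The \<open>\<complex>\<close>-algebra homomorphism that sends each variable \<open>x\<close> to \<open>f x\<close>.\<close>

definition poly_subst :: "('x \<Rightarrow> 'y cpoly) \<Rightarrow> 'x cpoly \<Rightarrow> 'y cpoly" where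
  "poly_subst f p =
     (\<Sum>m\<in>Poly_Mapping.keys p. Const (Poly_Mapping.lookup p m) * (\<Prod>x\<in>Poly_Mapping.keys m. f x ^ Poly_Mapping.lookup m x))"

lemma poly_ring_simps [simp]:
  "mult (poly_ring X) = (*)" "one (poly_ring X) = 1"
  "zero (poly_ring X) = 0" "add (poly_ring X) = (+)"
  by (simp_all add: poly_ring_def)

lemma carrier_poly_ring: "p \<in> carrier (poly_ring X) \<longleftrightarrow> (\<forall>m\<in>Poly_Mapping.keys p. Poly_Mapping.keys m \<subseteq> X)"
  by (simp add: poly_ring_def)

lemma poly_ring_mult_closed:
  assumes "p \<in> carrier (poly_ring X)" "q \<in> carrier (poly_ring X)"
  shows "p * q \<in> carrier (poly_ring X)"
  unfolding carrier_poly_ring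
proof
  fix m assume "m \<in> Poly_Mapping.keys (p * q)"
  then obtain a b where "a \<in> Poly_Mapping.keys p" "b \<in> Poly_Mapping.keys q" "m = a + b"
    using keys_mult[of p q] by blast
  then show "Poly_Mapping.keys m \<subseteq> X"
    using assms keys_add[of a b] unfolding carrier_poly_ring by blast
qed

lemma poly_ring_add_closed:
  assumes "p \<in> carrier (poly_ring X)" "q \<in> carrier (poly_ring X)"
  shows "p + q \<in> carrier (poly_ring X)"
  using assms keys_add[of p q] unfolding carrier_poly_ring by blast

lemma poly_ring_uminus_closed:
  assumes "p \<in> carrier (poly_ring X)"
  shows "- p \<in> carrier (poly_ring X)"
  using assms unfolding carrier_poly_ring by (simp add: in_keys_iff)

lemma poly_ring_one_closed: "1 \<in> carrier (poly_ring X)"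
  unfolding carrier_poly_ring by simp

lemma cring_poly_ring: "cring (poly_ring X)"
proof (rule cringI)
  show "abelian_group (poly_ring X)"
  proof (rule abelian_groupI)
    fix p assume "p \<in> carrier (poly_ring X)"
    then show "\<exists>q\<in>carrier (poly_ring X). q \<oplus>\<^bsub>poly_ring X\<^esub> p = \<zero>\<^bsub>poly_ring X\<^esub>"
      using poly_ring_uminus_closed by (intro bexI[of _ "- p"]) auto
  qed (auto simp: poly_ring_add_closed algebra_simps, simp add: carrier_poly_ring)
  show "Group.comm_monoid (poly_ring X)"
    by (rule Group.comm_monoidI)
      (auto simp: poly_ring_mult_closed poly_ring_one_closed algebra_simps)
qed (auto simp: algebra_simps)

lemma Var_closed: "x \<in> X \<Longrightarrow> Var x \<in> carrier (poly_ring X)"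
  unfolding carrier_poly_ring Var_def by simp

lemma Const_closed: "Const a \<in> carrier (poly_ring X)"
  unfolding carrier_poly_ring Const_def by simp

lemma poly_ring_power_closed:
  "p \<in> carrier (poly_ring X) \<Longrightarrow> p ^ n \<in> carrier (poly_ring X)"
  by (induction n) (auto simp: poly_ring_one_closed poly_ring_mult_closed)

lemma poly_ring_prod_closed:
  "(\<And>a. a \<in> A \<Longrightarrow> g a \<in> carrier (poly_ring X)) \<Longrightarrow> prod g A \<in> carrier (poly_ring X)"
  by (induction A rule: infinite_finite_induct)
    (auto simp: poly_ring_one_closed poly_ring_mult_closed)

lemma poly_ring_sum_closed:
  "(\<And>a. a \<in> A \<Longrightarrow> g a \<in> carrier (poly_ring X)) \<Longrightarrow> sum g A \<in> carrier (poly_ring X)"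
  by (induction A rule: infinite_finite_induct)
    (auto simp: poly_ring_add_closed, auto simp: carrier_poly_ring)

lemma poly_subst_superset:
  assumes "finite A" "Poly_Mapping.keys p \<subseteq> A"
  shows "poly_subst f p = (\<Sum>m\<in>A. Const (Poly_Mapping.lookup p m) * (\<Prod>x\<in>Poly_Mapping.keys m. f x ^ Poly_Mapping.lookup m x))"
  unfolding poly_subst_def
  by (rule sum.mono_neutral_left) (use assms in \<open>auto simp: in_keys_iff Const_def\<close>)

lemma Const_add: "Const (a + b) = Const a + Const b"
  by (simp add: Const_def single_add)

lemma Const_mult: "Const (a * b) = Const a * Const b"
  by (simp add: Const_def mult_single)

lemma poly_subst_add: "poly_subst f (p + q) = poly_subst f p + poly_subst f q"
proof -
  have "finite (Poly_Mapping.keys p \<union> Poly_Mapping.keys q)" by simp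
  then show ?thesis
    using poly_subst_superset[of "Poly_Mapping.keys p \<union> Poly_Mapping.keys q" "p + q" f]
      poly_subst_superset[of "Poly_Mapping.keys p \<union> Poly_Mapping.keys q" p f]
      poly_subst_superset[of "Poly_Mapping.keys p \<union> Poly_Mapping.keys q" q f] keys_add[of p q]
    by (simp add: lookup_add Const_add distrib_right sum.distrib)
qed

lemma poly_subst_sum: "poly_subst f (sum g A) = (\<Sum>a\<in>A. poly_subst f (g a))"
proof (induction A rule: infinite_finite_induct)
  case (insert x F)
  then show ?case by (simp add: poly_subst_add)
qed (simp_all add: poly_subst_def)

lemma monomial_subst_superset:
  fixes f :: "'x \<Rightarrow> 'y cpoly"
  assumes "finite A" "Poly_Mapping.keys m \<subseteq> A"
  shows "(\<Prod>x\<in>Poly_Mapping.keys m. f x ^ Poly_Mapping.lookup m x) = (\<Prod>x\<in>A. f x ^ Poly_Mapping.lookup m x)"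
  by (rule prod.mono_neutral_left) (use assms in \<open>auto simp: in_keys_iff\<close>)

lemma monomial_subst_add:
  fixes f :: "'x \<Rightarrow> 'y cpoly"
  shows "(\<Prod>x\<in>Poly_Mapping.keys (m + n). f x ^ Poly_Mapping.lookup (m + n) x) =
    (\<Prod>x\<in>Poly_Mapping.keys m. f x ^ Poly_Mapping.lookup m x) * (\<Prod>x\<in>Poly_Mapping.keys n. f x ^ Poly_Mapping.lookup n x)"
proof -
  have "finite (Poly_Mapping.keys m \<union> Poly_Mapping.keys n)" by simp
  then show ?thesis
    using monomial_subst_superset[of "Poly_Mapping.keys m \<union> Poly_Mapping.keys n" "m + n" f]
      monomial_subst_superset[of "Poly_Mapping.keys m \<union> Poly_Mapping.keys n" m f]
      monomial_subst_superset[of "Poly_Mapping.keys m \<union> Poly_Mapping.keys n" n f] keys_add[of m n]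
    by (simp add: lookup_add power_add prod.distrib)
qed

lemma poly_subst_single:
  "poly_subst f (Poly_Mapping.single m a) = Const a * (\<Prod>x\<in>Poly_Mapping.keys m. f x ^ Poly_Mapping.lookup m x)"
  by (simp add: poly_subst_def Const_def)

lemma cpoly_expansion: "p = (\<Sum>m\<in>Poly_Mapping.keys p. Poly_Mapping.single m (Poly_Mapping.lookup p m))" for p :: "'x cpoly"
  by (rule poly_mapping_eqI)
    (auto simp: lookup_sum lookup_single when_def in_keys_iff sum.delta)

lemma poly_subst_mult: "poly_subst f (p * q) = poly_subst f p * poly_subst f q"
proof -
  have "p * q = (\<Sum>m\<in>Poly_Mapping.keys p. \<Sum>n\<in>Poly_Mapping.keys q.
      Poly_Mapping.single (m + n) (Poly_Mapping.lookup p m * Poly_Mapping.lookup q n))"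
    by (subst cpoly_expansion[of p], subst cpoly_expansion[of q])
      (simp add: sum_product mult_single)
  then show ?thesis
    by (simp add: poly_subst_sum poly_subst_single monomial_subst_add Const_mult
        poly_subst_def[of f p] poly_subst_def[of f q] sum_product mult.assoc mult.left_commute)
qed

lemma poly_subst_Var [simp]: "poly_subst f (Var x) = f x"
  by (simp add: Var_def poly_subst_single Const_def)

lemma poly_subst_Const [simp]: "poly_subst f (Const a) = Const a"
  by (simp add: Const_def poly_subst_single)

lemma poly_subst_closed:
  assumes "p \<in> carrier (poly_ring X)" "\<And>x. x \<in> X \<Longrightarrow> f x \<in> carrier (poly_ring Y)"
  shows "poly_subst f p \<in> carrier (poly_ring Y)"
  unfolding poly_subst_def
proof (intro poly_ring_sum_closed poly_ring_mult_closed poly_ring_prod_closed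
    poly_ring_power_closed Const_closed)
  fix m x assume "m \<in> Poly_Mapping.keys p" "x \<in> Poly_Mapping.keys m"
  then show "f x \<in> carrier (poly_ring Y)"
    using assms unfolding carrier_poly_ring by blast
qed

lemma poly_subst_ring_hom:
  assumes "\<And>x. x \<in> X \<Longrightarrow> f x \<in> carrier (poly_ring Y)"
  shows "poly_subst f \<in> ring_hom (poly_ring X) (poly_ring Y)"
  by (rule ring_hom_memI)
    (auto simp: poly_subst_closed assms poly_subst_add poly_subst_mult
      poly_subst_def[of f 1] Const_def)


section \<open>Treks and choke points\<close>

text \<open>Undirected paths are lists of distinct vertices.  The arcs of such a path are the arcs
  of the digraph \<open>G\<close> it runs along, in either direction.\<close>

definition path_arcs :: "'v pair_pre_digraph \<Rightarrow> 'v list \<Rightarrow> ('v \<times> 'v) set" where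
  "path_arcs G p =
     {(u, v) \<in> parcs G. (u, v) \<in> set (vwalk_arcs p) \<or> (v, u) \<in> set (vwalk_arcs p)}"

definition collider_free :: "'v pair_pre_digraph \<Rightarrow> 'v list \<Rightarrow> bool" where
  "collider_free G p \<longleftrightarrow>
     (\<forall>i j k. (i, k) \<in> path_arcs G p \<and> (j, k) \<in> path_arcs G p \<longrightarrow> i = j)"

definition treks :: "'v pair_pre_digraph \<Rightarrow> 'v \<Rightarrow> 'v \<Rightarrow> 'v list set" where
  "treks G i j =
     {p. vpath p (mk_symmetric G) \<and> hd p = i \<and> last p = j \<and> collider_free G p}"

text \<open>The topmost vertex is the one that no arc of the trek enters; it is unique when \<open>G\<close> is
  acyclic.\<close>

definition trek_top :: "'v pair_pre_digraph \<Rightarrow> 'v list \<Rightarrow> 'v" where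
  "trek_top G p = (THE t. t \<in> set p \<and> (\<forall>u. (u, t) \<notin> path_arcs G p))"

text \<open>A trek from \<open>i\<close> to \<open>j\<close> is listed starting from \<open>i\<close>; its two sides share the top.\<close>

definition start_side :: "'v pair_pre_digraph \<Rightarrow> 'v list \<Rightarrow> 'v set" where
  "start_side G p = insert (trek_top G p) (set (takeWhile (\<lambda>v. v \<noteq> trek_top G p) p))"

definition end_side :: "'v pair_pre_digraph \<Rightarrow> 'v list \<Rightarrow> 'v set" where
  "end_side G p = set (dropWhile (\<lambda>v. v \<noteq> trek_top G p) p)"

definition choke_point :: "'v pair_pre_digraph \<Rightarrow> 'v set \<Rightarrow> 'v set \<Rightarrow> 'v \<Rightarrow> bool" where
  "choke_point G I J c \<longleftrightarrow> c \<in> pverts G \<and>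
     (\<forall>i\<in>I. \<forall>j\<in>J. \<forall>p\<in>treks G i j. c \<in> set p) \<and>
     ((\<forall>i\<in>I. \<forall>j\<in>J. \<forall>p\<in>treks G i j. c \<in> start_side G p) \<or>
      (\<forall>i\<in>I. \<forall>j\<in>J. \<forall>p\<in>treks G i j. c \<in> end_side G p))"


section \<open>The ideals\<close>

datatype 'v param = A_par 'v | Lambda_par "'v \<times> 'v"

definition params :: "'v pair_pre_digraph \<Rightarrow> 'v param set" where
  "params G = A_par ` pverts G \<union> Lambda_par ` parcs G"

definition trek_sum :: "'v pair_pre_digraph \<Rightarrow> 'v \<Rightarrow> 'v \<Rightarrow> 'v param cpoly" where
  "trek_sum G i j =
     (\<Sum>p\<in>treks G i j. Var (A_par (trek_top G p)) * (\<Prod>e\<in>path_arcs G p. Var (Lambda_par e)))"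

lemma set_vwalk_arcs_rev: "set (vwalk_arcs (rev p)) = (set (vwalk_arcs p))\<inverse>"
proof (induction p rule: vwalk_arcs.induct)
  case (3 x y xs)
  have "vwalk_arcs ((rev xs @ [y]) @ [x]) = vwalk_arcs (rev xs @ [y]) @ [(y, x)]"
    by (subst vwalk_arcs_append) auto
  then show ?case using 3 by auto
qed auto

lemma path_arcs_rev: "path_arcs G (rev p) = path_arcs G p"
  by (auto simp: path_arcs_def set_vwalk_arcs_rev)

lemma trek_top_rev: "trek_top G (rev p) = trek_top G p"
  by (simp add: trek_top_def path_arcs_rev)

lemma parcs_mk_symmetric_converse: "(parcs (mk_symmetric G))\<inverse> = parcs (mk_symmetric G)"
  by (auto simp: mk_symmetric_def)

lemma treks_rev: "p \<in> treks G i j \<Longrightarrow> rev p \<in> treks G j i"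
  using parcs_mk_symmetric_converse[of "with_proj G"]
  by (auto simp: treks_def vpath_def vwalk_def set_vwalk_arcs_rev collider_free_def
      path_arcs_rev hd_rev last_rev)

lemma trek_sum_commute: "trek_sum G i j = trek_sum G j i"
proof -
  have "bij_betw rev (treks G i j) (treks G j i)"
    by (rule bij_betw_byWitness[where f' = rev]) (auto simp: treks_rev)
  from sum.reindex_bij_betw[OF this, of "\<lambda>p. Var (A_par (trek_top G p)) *
      (\<Prod>e\<in>path_arcs G p. Var (Lambda_par e))"]
  show ?thesis
    unfolding trek_sum_def by (simp add: trek_top_rev path_arcs_rev)
qed

text \<open>The variables \<open>\<sigma>\<^sub>i\<^sub>j = \<sigma>\<^sub>j\<^sub>i\<close> are indexed by unordered pairs, including those with \<open>i = j\<close>.\<close>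

abbreviation sigma :: "'v \<Rightarrow> 'v \<Rightarrow> 'v uprod cpoly" where
  "sigma i j \<equiv> Var (Upair i j)"

definition sigma_ring :: "'v set \<Rightarrow> 'v uprod cpoly ring" where
  "sigma_ring V = poly_ring {Upair i j | i j. i \<in> V \<and> j \<in> V}"

lift_definition sigma_image :: "'v pair_pre_digraph \<Rightarrow> 'v uprod \<Rightarrow> 'v param cpoly"
  is "\<lambda>G (i, j). trek_sum G i j"
  by (auto simp: trek_sum_commute)

definition phi :: "'v pair_pre_digraph \<Rightarrow> 'v uprod cpoly \<Rightarrow> 'v param cpoly" where
  "phi G = poly_subst (sigma_image G)"

lemma phi_sigma: "phi G (sigma i j) = trek_sum G i j"
  by (simp add: phi_def sigma_image.abs_eq Upair.abs_eq)

definition trek_ideal :: "'v pair_pre_digraph \<Rightarrow> 'v uprod cpoly set" where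
  "trek_ideal G = a_kernel (sigma_ring (pverts G)) (poly_ring (params G)) (phi G)"

definition observed_trek_ideal :: "'v pair_pre_digraph \<Rightarrow> 'v set \<Rightarrow> 'v uprod cpoly set" where
  "observed_trek_ideal G V = trek_ideal G \<inter> carrier (sigma_ring V)"


section \<open>Rooted directed trees\<close>

text \<open>In the symmetric digraph \<^term>\<open>mk_symmetric T\<close> going back and forth along an edge is a
  cycle of length 2; the cycles of the underlying undirected graph are those of length at
  least 3.  The constant \<^const>\<open>forest\<close> of the library only forbids directed cycles.\<close>

locale rooted_directed_tree = pair_digraph T for T :: "'v pair_pre_digraph" +
  fixes r :: 'v
  assumes no_antiparallel: "(u, v) \<in> parcs T \<Longrightarrow> (v, u) \<notin> parcs T"
    and underlying_connected: "connected T"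
    and underlying_acyclic: "pre_digraph.cycle (mk_symmetric T) c \<Longrightarrow> length c < 3"
    and root_in_verts: "r \<in> pverts T"
    and away_from_root: "vpath p (mk_symmetric T) \<Longrightarrow> hd p = r \<Longrightarrow> set (vwalk_arcs p) \<subseteq> parcs T"

text \<open>Leaves are the vertices without children, so a root with a single child is not a leaf.\<close>

definition leaves :: "'v pair_pre_digraph \<Rightarrow> 'v set" where
  "leaves T = {v \<in> pverts T. out_degree T v = 0}"

end

theory Submission
  imports Defs
begin

text \<open>In a tree there is a single trek between any two vertices, so \<open>\<phi>\<close> sends variables to monomials and
  the ideal is spanned by differences of monomials with equal image. Read a monomial in the
  leaf variables as a multiset of pairs of leaves; its image records how many of the paths use each
  arc and how many have each top. A tetrad exchanges the ends of two paths at a common vertex.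
  Let \<open>M\<close> and \<open>N\<close> have the same image and let \<open>{i, k}\<close> be a pair of \<open>M\<close> with a deepest top \<open>v\<close>.
  The paths of \<open>N\<close> that start at \<open>i\<close> and \<open>k\<close> also visit \<open>v\<close>, and exchanging ends at \<open>v\<close>
  creates the pair \<open>{i, k}\<close> in \<open>N\<close>. It is then cancelled, and induction applies.\<close>

section \<open>Paths in a rooted directed tree\<close>

lemma path_arcs_Nil [simp]: "path_arcs G [] = {}"
  and path_arcs_single [simp]: "path_arcs G [x] = {}"
  by (auto simp: path_arcs_def)

lemma path_arcs_Cons_Cons:
  "path_arcs G (x # y # p) = path_arcs G (y # p) \<union> ({(x, y), (y, x)} \<inter> parcs G)"
  by (auto simp: path_arcs_def)

lemma vpath_singleton:
  fixes G :: "'v pair_pre_digraph"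
  shows "vpath [x] (mk_symmetric G) \<longleftrightarrow> x \<in> pverts G"
  by (auto simp: vpath_def vwalk_def)

lemma vpath_Cons_Cons:
  fixes G :: "'v pair_pre_digraph"
  shows "vpath (x # y # p) (mk_symmetric G) \<longleftrightarrow>
    x \<in> pverts G \<and> x \<notin> set (y # p) \<and> ((x, y) \<in> parcs G \<or> (y, x) \<in> parcs G) \<and>
    vpath (y # p) (mk_symmetric G)"
proof -
  have "(x, y) \<in> parcs (mk_symmetric G) \<longleftrightarrow> (x, y) \<in> parcs G \<or> (y, x) \<in> parcs G"
    by (auto simp: parcs_mk_symmetric intro: bexI[of _ "(x, y)"] bexI[of _ "(y, x)"])
  then show ?thesis by (auto simp: vpath_def vwalk_def)
qed

lemma vpath_append_join:
  fixes G :: "'v pair_pre_digraph"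
  assumes "p \<noteq> []" "q \<noteq> []"
  shows "vpath (p @ q) (mk_symmetric G) \<longleftrightarrow>
    vpath p (mk_symmetric G) \<and> vpath q (mk_symmetric G) \<and> set p \<inter> set q = {} \<and>
    ((last p, hd q) \<in> parcs G \<or> (hd q, last p) \<in> parcs G)"
  using assms(1)
proof (induction p rule: list_nonempty_induct)
  case (single x)
  then show ?case using assms(2)
    by (cases q) (auto simp: vpath_Cons_Cons vpath_singleton)
next
  case (cons x xs)
  then obtain y ys where "xs = y # ys" by (cases xs) auto
  with cons show ?case by (auto simp: vpath_Cons_Cons)
qed

lemma vpath_rev:
  fixes G :: "'v pair_pre_digraph"
  shows "vpath (rev p) (mk_symmetric G) \<longleftrightarrow> vpath p (mk_symmetric G)"
proof (induction p rule: induct_list012)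
  case (3 x y zs)
  have "vpath (rev (x # y # zs)) (mk_symmetric G) \<longleftrightarrow> vpath (rev (y # zs) @ [x]) (mk_symmetric G)"
    by simp
  also have "\<dots> \<longleftrightarrow> vpath (rev (y # zs)) (mk_symmetric G) \<and> x \<in> pverts G \<and> x \<notin> set (y # zs) \<and>
      ((x, y) \<in> parcs G \<or> (y, x) \<in> parcs G)"
    by (subst vpath_append_join) (auto simp: vpath_singleton)
  finally show ?case using 3 by (auto simp: vpath_Cons_Cons)
qed auto

lemma vpath_nonempty: "vpath p G \<Longrightarrow> p \<noteq> []"
  by (auto simp: vpath_def vwalk_def)

lemma vpath_verts:
  fixes G :: "'v pair_pre_digraph"
  shows "vpath p (mk_symmetric G) \<Longrightarrow> set p \<subseteq> pverts G"
  by (auto simp: vpath_def vwalk_def)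

lemma path_arcs_verts: "(u, w) \<in> path_arcs G p \<Longrightarrow> u \<in> set p \<and> w \<in> set p"
  by (auto simp: path_arcs_def dest: in_set_vwalk_arcsE[of u w p] in_set_vwalk_arcsE[of w u p]
      elim: in_set_vwalk_arcsE)

context rooted_directed_tree
begin

lemma ex_vpath:
  assumes "u \<in> pverts T" "v \<in> pverts T"
  obtains p where "vpath p (mk_symmetric T)" "hd p = u" "last p = v"
proof -
  interpret S: pair_wf_digraph "mk_symmetric T"
    using wellformed_mk_symmetric .
  have "u \<rightarrow>\<^sup>*\<^bsub>mk_symmetric T\<^esub> v"
    using underlying_connected assms unfolding connected_def by auto
  then show ?thesis using S.reachable_vpath_conv[of u v] that by auto
qed

text \<open>A parent \<open>u\<close> of \<open>r\<close> would make \<open>[r, u]\<close> a path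
  from the root that runs against its arc.\<close>

lemma root_no_parent: "(u, r) \<notin> parcs T"
proof
  assume "(u, r) \<in> parcs T"
  moreover from this have "u \<noteq> r" using pair_no_loops by fastforce
  ultimately have "vpath [r, u] (mk_symmetric T)"
    using root_in_verts in_arcsD1 by (auto simp: vpath_Cons_Cons vpath_singleton)
  from away_from_root[OF this] have "(r, u) \<in> parcs T" by simp
  then show False using no_antiparallel \<open>(u, r) \<in> parcs T\<close> by blast
qed

text \<open>A simple path from the root to \<open>w\<close> arrives through one parent \<open>x\<close>; another parent \<open>y\<close>
  would allow a detour that traverses \<open>x \<rightarrow> w\<close> or \<open>y \<rightarrow> w\<close> against its direction.\<close>

lemma parent_unique:
  assumes "(u, w) \<in> parcs T" "(u', w) \<in> parcs T"
  shows "u = u'"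
proof (rule ccontr)
  assume "u \<noteq> u'"
  have w: "w \<in> pverts T" using assms in_arcsD2 by blast
  obtain p where p: "vpath p (mk_symmetric T)" "hd p = r" "last p = w"
    using ex_vpath[OF root_in_verts w] .
  have "w \<noteq> r" using assms root_no_parent by blast
  have "p \<noteq> []" using p(1) vpath_nonempty by auto
  then obtain p' where p': "p = p' @ [w]" using p(3) by (metis append_butlast_last_id)
  have "p' \<noteq> []" using p p' \<open>w \<noteq> r\<close> by auto
  define x where "x = last p'"
  have xw: "(x, w) \<in> parcs T"
    using away_from_root[OF p(1,2)] \<open>p' \<noteq> []\<close> by (auto simp: p' x_def vwalk_arcs_append)
  obtain y where y: "(y, w) \<in> parcs T" "y \<noteq> x" using assms \<open>u \<noteq> u'\<close> by blast
  have ywne: "y \<noteq> w" using y pair_no_loops by fastforce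
  show False
  proof (cases "y \<in> set p'")
    case False
    then have "vpath (p @ [y]) (mk_symmetric T)"
      using p y ywne \<open>p \<noteq> []\<close> in_arcsD1
      by (subst vpath_append_join) (auto simp: vpath_singleton p')
    from away_from_root[OF this] have "(w, y) \<in> parcs T"
      using p \<open>p \<noteq> []\<close> by (auto simp: vwalk_arcs_append)
    then show False using no_antiparallel y by blast
  next
    case True
    then obtain a b where ab: "p' = a @ y # b" by (auto simp: in_set_conv_decomp)
    have "b \<noteq> []" using ab y(2) by (auto simp: x_def)
    have 1: "vpath ((a @ [y]) @ (b @ [w])) (mk_symmetric T)" using p ab p' by simp
    have P1: "vpath (a @ [y]) (mk_symmetric T)" and P2: "vpath (b @ [w]) (mk_symmetric T)"
      and d: "set (a @ [y]) \<inter> set (b @ [w]) = {}"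
      using 1 by (auto simp: vpath_append_join simp del: append_assoc)
    \<comment> \<open>The detour follows \<open>p\<close> to \<open>y\<close>, jumps to
      \<open>w\<close> and runs the rest of \<open>p'\<close> backwards. Since \<open>b\<close> ends
      in \<open>x\<close>, it goes from \<open>w\<close> to \<open>x\<close>.\<close>
    have "vpath (rev (b @ [w])) (mk_symmetric T)" using P2 by (simp only: vpath_rev)
    then have "vpath ((a @ [y]) @ rev (b @ [w])) (mk_symmetric T)"
      using P1 d y(1) by (subst vpath_append_join) auto
    moreover have "hd ((a @ [y]) @ rev (b @ [w])) = r"
      using p(2) by (cases a) (auto simp: p' ab)
    ultimately have "set (vwalk_arcs ((a @ [y]) @ rev (b @ [w]))) \<subseteq> parcs T"
      by (rule away_from_root)
    moreover obtain b' where "b = b' @ [x]"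
      using \<open>b \<noteq> []\<close> ab by (metis append_butlast_last_id last_ConsR last_appendR list.discI x_def)
    then have "(w, x) \<in> set (vwalk_arcs ((a @ [y]) @ rev (b @ [w])))"
      using set_vwalk_arcs_append2[of "rev (b @ [w])" "a @ [y]"] by auto
    ultimately have "(w, x) \<in> parcs T" by blast
    then show False using no_antiparallel xw by blast
  qed
qed

section \<open>The ancestor order of the tree\<close>

abbreviation anc :: "'v \<Rightarrow> 'v \<Rightarrow> bool" where
  "anc u v \<equiv> (u, v) \<in> (parcs T)\<^sup>*"

lemma anc_parent: "anc w v \<Longrightarrow> w \<noteq> v \<Longrightarrow> (u, v) \<in> parcs T \<Longrightarrow> anc w u"
  by (metis parent_unique rtranclE)

text \<open>Parents are unique, so going up from \<open>x\<close> is deterministic and meets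
  \<open>u\<close> and \<open>v\<close> one after the other.\<close>

lemma anc_chain: "anc u x \<Longrightarrow> anc v x \<Longrightarrow> anc u v \<or> anc v u"
proof -
  have sv: "single_valued ((parcs T)\<inverse>)"
    using parent_unique by (auto simp: single_valued_def)
  assume "anc u x" "anc v x"
  then show ?thesis
    using single_valued_confluent[OF sv, of x u v] by (auto simp: rtrancl_converse)
qed

lemma anc_verts: "anc u v \<Longrightarrow> v \<in> pverts T \<Longrightarrow> u \<in> pverts T"
  by (metis converse_rtranclE in_arcsD1)

lemma root_anc:
  assumes "v \<in> pverts T"
  shows "anc r v"
proof -
  obtain p where p: "vpath p (mk_symmetric T)" "hd p = r" "last p = v"
    using ex_vpath[OF root_in_verts assms] .
  have "set (vwalk_arcs p) \<subseteq> parcs T" using p away_from_root by blast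
  moreover have "p \<noteq> []" using p(1) vpath_nonempty by auto
  ultimately have "(hd p, last p) \<in> (parcs T)\<^sup>*"
    by (induction p rule: induct_list012) (auto intro: converse_rtrancl_into_rtrancl)
  then show ?thesis using p by simp
qed

text \<open>Induction along the descent from the root: a cycle through \<open>z\<close> enters it
  from its only parent \<open>y\<close>, hence is also a cycle through \<open>y\<close>, and nothing
  enters the root.\<close>

lemma acyclic_tree: "(v, v) \<notin> (parcs T)\<^sup>+"
proof
  assume c: "(v, v) \<in> (parcs T)\<^sup>+"
  then have "v \<in> pverts T" using in_arcsD2 by (metis tranclE)
  then have "anc r v" by (rule root_anc)
  then have "(v, v) \<notin> (parcs T)\<^sup>+"
  proof (induction rule: rtrancl_induct)
    case base
    then show ?case using root_no_parent by (metis tranclE)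
  next
    case (step y z)
    then show ?case
      by (metis parent_unique rtrancl_into_trancl2 rtrancl_trancl_trancl tranclD2)
  qed
  then show False using c by blast
qed

lemma anc_antisym: "anc u v \<Longrightarrow> anc v u \<Longrightarrow> u = v"
  using acyclic_tree by (metis rtranclD trancl_trans)

lemma child_not_anc: "(u, w) \<in> parcs T \<Longrightarrow> \<not> anc w u"
  using acyclic_tree by (meson rtrancl_into_trancl1 rtrancl_into_trancl2)

definition depth :: "'v \<Rightarrow> nat" where
  "depth v = card {u. anc u v}"

lemma depth_mono:
  assumes "anc u v" "u \<noteq> v" "v \<in> pverts T"
  shows "depth u < depth v"
proof -
  have "{x. anc x v} \<subseteq> pverts T" using anc_verts assms by auto
  then have "finite {x. anc x v}" using pair_finite_verts finite_subset by blast
  moreover have "{x. anc x u} \<subset> {x. anc x v}"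
    using assms anc_antisym by (auto intro: rtrancl_trans)
  ultimately show ?thesis unfolding depth_def by (rule psubset_card_mono)
qed

lemma anc_child: "anc v x \<Longrightarrow> v \<noteq> x \<Longrightarrow> \<exists>w. (v, w) \<in> parcs T \<and> anc w x"
  by (meson converse_rtranclE)

text \<open>Both children lie above \<open>x\<close>, so they are comparable. If they differed, the
  upper one would lie above its own parent \<open>v\<close>.\<close>

lemma child_unique:
  assumes "(v, w) \<in> parcs T" "(v, w') \<in> parcs T" "anc w x" "anc w' x"
  shows "w = w'"
  using anc_chain[OF assms(3,4)] assms anc_parent child_not_anc by metis

lemma ex_parent:
  assumes "v \<in> pverts T" "v \<noteq> r"
  obtains u where "(u, v) \<in> parcs T"
  using root_anc[OF assms(1)] assms(2) by (metis rtranclE)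

section \<open>Which arcs a simple path uses, and uniqueness of paths\<close>

lemma anc_arc_iff: "(a, b) \<in> parcs T \<Longrightarrow> anc w a \<noteq> anc w b \<longleftrightarrow> b = w"
  by (metis anc_parent child_not_anc rtrancl.rtrancl_into_rtrancl rtrancl.rtrancl_refl)

text \<open>The arc into \<open>w\<close> is the only edge between the subtree below
  \<open>w\<close> and the rest of the tree, and a simple path uses it at most once. The arcs of a
  path are thus determined by its ends.\<close>

lemma crossing_arcs:
  assumes "vpath p (mk_symmetric T)" "(u, w) \<in> parcs T"
  shows "(u, w) \<in> path_arcs T p \<longleftrightarrow> anc w (hd p) \<noteq> anc w (last p)"
  using assms(1)
proof (induction p rule: induct_list012)
  case (3 x y zs)
  then have p: "vpath (y # zs) (mk_symmetric T)" "x \<notin> set (y # zs)"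
    and e: "(x, y) \<in> parcs T \<or> (y, x) \<in> parcs T"
    by (auto simp: vpath_Cons_Cons)
  have IH: "(u, w) \<in> path_arcs T (y # zs) \<longleftrightarrow> anc w y \<noteq> anc w (last (y # zs))"
    using "3.IH"(2) p by simp
  have *: "anc w x \<noteq> anc w y \<longleftrightarrow> (u, w) = (x, y) \<or> (u, w) = (y, x)"
    using e anc_arc_iff parent_unique[OF assms(2)] assms(2) no_antiparallel
    by (metis prod.inject)
  have **: "(u, w) = (x, y) \<or> (u, w) = (y, x) \<Longrightarrow> (u, w) \<notin> path_arcs T (y # zs)"
    using p(2) path_arcs_verts[of u w T "y # zs"] by auto
  have "(u, w) \<in> path_arcs T (x # y # zs) \<longleftrightarrow>
      (u, w) \<in> path_arcs T (y # zs) \<or> (u, w) = (x, y) \<or> (u, w) = (y, x)"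
    using assms(2) by (auto simp: path_arcs_Cons_Cons)
  then show ?case using IH * ** by auto
qed (auto simp: vpath_def vwalk_def)

text \<open>Apply \<open>crossing_arcs\<close> to the first edge. The next vertex is forced: the
  child towards the target if the target lies below \<open>x\<close>, the parent otherwise.\<close>

lemma vpath_first_step:
  assumes "vpath (x # y # zs) (mk_symmetric T)"
  shows "if anc x (last (y # zs)) then (x, y) \<in> parcs T \<and> anc y (last (y # zs))
    else (y, x) \<in> parcs T"
proof -
  consider "(x, y) \<in> parcs T" | "(y, x) \<in> parcs T"
    using assms by (auto simp: vpath_Cons_Cons)
  then show ?thesis
  proof cases
    case 1
    then have "(x, y) \<in> path_arcs T (x # y # zs)" by (simp add: path_arcs_Cons_Cons)
    then have "anc y x \<noteq> anc y (last (y # zs))" using crossing_arcs[OF assms 1] by simp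
    then show ?thesis using 1 child_not_anc converse_rtrancl_into_rtrancl by metis
  next
    case 2
    then have "(y, x) \<in> path_arcs T (x # y # zs)" by (simp add: path_arcs_Cons_Cons)
    then show ?thesis using crossing_arcs[OF assms 2] 2 by simp
  qed
qed

lemma vpath_unique:
  assumes "vpath p (mk_symmetric T)" "vpath q (mk_symmetric T)" "hd p = hd q" "last p = last q"
  shows "p = q"
  using assms
proof (induction p arbitrary: q rule: induct_list012)
  case 1
  then show ?case using vpath_nonempty by auto
next
  case (2 x)
  then show ?case
    by (cases q rule: remdups_adj.cases) (auto simp: vpath_def vwalk_def split: if_splits)
next
  case (3 x y zs)
  have "hd q = x" "last q = last (y # zs)" using "3.prems" by auto
  moreover have "last (y # zs) \<noteq> x" "q \<noteq> []"
    using "3.prems" vpath_nonempty last_in_set[of "y # zs"] by (auto simp: vpath_Cons_Cons)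
  ultimately obtain y' zs' where q: "q = x # y' # zs'"
    by (cases q rule: remdups_adj.cases) auto
  have l: "last (y' # zs') = last (y # zs)" using 3 q by auto
  have "y = y'"
    using vpath_first_step[of x y zs] vpath_first_step[of x y' zs'] "3.prems"(1,2) l
      child_unique[of x y y'] parent_unique[of y x y'] unfolding q
    by (auto simp del: last.simps split: if_splits)
  then have "y # zs = y' # zs'"
    using "3.prems" l q by (intro "3.IH"(2)) (auto simp: vpath_Cons_Cons)
  then show ?case using q by simp
qed

section \<open>The path between two vertices, its top and its two sides\<close>

definition path :: "'v \<Rightarrow> 'v \<Rightarrow> 'v list" where
  "path i j = (THE p. vpath p (mk_symmetric T) \<and> hd p = i \<and> last p = j)"

lemma path_props:
  assumes "i \<in> pverts T" "j \<in> pverts T"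
  shows "vpath (path i j) (mk_symmetric T)" "hd (path i j) = i" "last (path i j) = j"
proof -
  have "\<exists>!p. vpath p (mk_symmetric T) \<and> hd p = i \<and> last p = j"
    using ex_vpath[OF assms] vpath_unique by metis
  from theI'[OF this] show "vpath (path i j) (mk_symmetric T)" "hd (path i j) = i" "last (path i j) = j"
    unfolding path_def by auto
qed

lemma path_eqI:
  assumes "vpath p (mk_symmetric T)" "hd p = i" "last p = j"
  shows "path i j = p"
proof -
  have "i \<in> pverts T" "j \<in> pverts T"
    using assms vpath_verts[OF assms(1)] vpath_nonempty[OF assms(1)] by auto
  then show ?thesis using assms path_props vpath_unique by metis
qed

text \<open>A collider would give a vertex two parents, so every simple path is a trek.\<close>

lemma treks_eq:
  assumes "i \<in> pverts T" "j \<in> pverts T"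
  shows "treks T i j = {path i j}"
proof -
  have "collider_free T p" for p
    unfolding collider_free_def path_arcs_def using parent_unique by blast
  moreover have "p = path i j" if "vpath p (mk_symmetric T)" "hd p = i" "last p = j" for p
    using path_eqI[OF that] by simp
  ultimately show ?thesis unfolding treks_def using path_props[OF assms] by blast
qed

text \<open>If \<open>v\<close> lies above \<open>y\<close>, it also lies above \<open>x\<close>,
  unless the first step descends into \<open>y = v\<close>. In that case the target lies below
  \<open>v\<close> by \<open>vpath_first_step\<close>.\<close>

lemma vpath_anc_ends:
  assumes "vpath p (mk_symmetric T)" "v \<in> set p"
  shows "anc v (hd p) \<or> anc v (last p)"
  using assms
proof (induction p rule: induct_list012)
  case (3 x y zs)
  show ?case
  proof (cases "v = x")
    case False
    then have "anc v y \<or> anc v (last (y # zs))"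
      using 3 by (auto simp: vpath_Cons_Cons simp del: last.simps)
    moreover have "anc v x \<or> anc v (last (y # zs))" if "anc v y"
      using vpath_first_step[OF "3.prems"(1)] that
      by (metis anc_parent rtrancl.rtrancl_into_rtrancl)
    ultimately show ?thesis by auto
  qed auto
qed auto

text \<open>The subtree below \<open>s\<close> can be left only from \<open>s\<close> to its parent,
  but \<open>vpath_first_step\<close> forces a descent at \<open>s\<close> because the target lies
  below \<open>s\<close>.\<close>

lemma common_anc_vpath:
  assumes "vpath p (mk_symmetric T)" "anc s (hd p)" "anc s (last p)" "v \<in> set p"
  shows "anc s v"
  using assms
proof (induction p rule: induct_list012)
  case (3 x y zs)
  have "anc s y"
  proof (rule ccontr)
    assume n: "\<not> anc s y"
    then have "(y, x) \<in> parcs T" "x = s"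
      using "3.prems"(1,2) anc_arc_iff[of y x s] by (auto simp: vpath_Cons_Cons intro: rtrancl.rtrancl_into_rtrancl)
    then show False
      using vpath_first_step[OF "3.prems"(1)] "3.prems"(3) no_antiparallel[of x y] by auto
  qed
  then show ?case
    using 3 by (auto simp: vpath_Cons_Cons)
qed auto

text \<open>If no path arc enters \<open>t\<close>, then both ends lie below \<open>t\<close> or
  neither does, by \<open>crossing_arcs\<close>; \<open>vpath_anc_ends\<close> excludes the latter.
  Two such vertices lie above each other by \<open>common_anc_vpath\<close>, which justifies the
  \<open>THE\<close> in \<open>trek_top\<close>.\<close>

lemma vpath_top:
  assumes p: "vpath p (mk_symmetric T)"
  shows "trek_top T p \<in> set p" "anc (trek_top T p) (hd p)" "anc (trek_top T p) (last p)"
proof -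
  define P where "P = (\<lambda>t. t \<in> set p \<and> (\<forall>u. (u, t) \<notin> path_arcs T p))"
  have common: "anc t (hd p) \<and> anc t (last p)" if "P t" for t
  proof -
    have t: "t \<in> set p" "t \<in> pverts T" using that vpath_verts[OF p] by (auto simp: P_def)
    have 1: "hd p \<in> pverts T" "last p \<in> pverts T"
      using vpath_verts[OF p] vpath_nonempty[OF p] by auto
    show ?thesis
    proof (cases "t = r")
      case True
      then show ?thesis using 1 root_anc by auto
    next
      case False
      then obtain u where "(u, t) \<in> parcs T" using ex_parent t by blast
      then show ?thesis
        using crossing_arcs[OF p, of u t] vpath_anc_ends[OF p t(1)] that by (auto simp: P_def)
    qed
  qed
  \<comment> \<open>Existence: a vertex of least depth on \<open>p\<close>, since the tail of an arc
    entering it would have smaller depth.\<close>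
  obtain t where t: "t \<in> set p" "\<And>v. v \<in> set p \<Longrightarrow> depth t \<le> depth v"
    using ex_min_if_finite[of "depth ` set p"] vpath_nonempty[OF p]
    by (metis (no_types, lifting) List.finite_set arg_min_if_finite(1,2) linorder_not_less set_empty)
  have Pt: "P t"
    unfolding P_def
  proof (intro conjI allI notI t)
    fix u assume u: "(u, t) \<in> path_arcs T p"
    then have "(u, t) \<in> parcs T" "u \<in> set p"
      using path_arcs_verts[OF u] by (auto simp: path_arcs_def)
    then have "depth u < depth t"
      using in_arcsD2 pair_no_loops by (intro depth_mono) fastforce+
    then show False using t(2)[OF \<open>u \<in> set p\<close>] by simp
  qed
  have "t' = t" if "P t'" for t'
    using common_anc_vpath[OF p] common[OF Pt] common[OF that] that Pt anc_antisym
    unfolding P_def by blast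
  with Pt have "(THE t. P t) = t" by (rule the_equality)
  then have "trek_top T p = t" unfolding trek_top_def P_def .
  then show "trek_top T p \<in> set p" "anc (trek_top T p) (hd p)" "anc (trek_top T p) (last p)"
    using t(1) common[OF Pt] by simp_all
qed

text \<open>This is the lowest common ancestor, by \<open>top_anc\<close> and
  \<open>anc_top\<close>.\<close>

definition top :: "'v \<Rightarrow> 'v \<Rightarrow> 'v" where
  "top i j = trek_top T (path i j)"

lemma top_anc:
  assumes "i \<in> pverts T" "j \<in> pverts T"
  shows "anc (top i j) i" "anc (top i j) j"
  using vpath_top[OF path_props(1)[OF assms]] path_props[OF assms] unfolding top_def by auto

lemma anc_top:
  assumes "i \<in> pverts T" "j \<in> pverts T" "anc s i" "anc s j"
  shows "anc s (top i j)"
  using common_anc_vpath[OF path_props(1)[OF assms(1,2)]] vpath_top(1)[OF path_props(1)[OF assms(1,2)]]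
    path_props[OF assms(1,2)] assms unfolding top_def by auto

lemma top_eqI:
  assumes "i \<in> pverts T" "j \<in> pverts T" "anc t i" "anc t j" "\<And>s. anc s i \<Longrightarrow> anc s j \<Longrightarrow> anc s t"
  shows "top i j = t"
  using assms anc_antisym anc_top top_anc by metis

lemma top_commute:
  assumes "i \<in> pverts T" "j \<in> pverts T"
  shows "top i j = top j i"
  using assms top_anc anc_top by (intro top_eqI) auto

lemma top_self: "i \<in> pverts T \<Longrightarrow> top i i = i"
  by (rule top_eqI) auto

lemma path_arcs_path:
  assumes "i \<in> pverts T" "j \<in> pverts T"
  shows "path_arcs T (path i j) = {(u, w) \<in> parcs T. anc w i \<noteq> anc w j}"
proof -
  have "path_arcs T (path i j) \<subseteq> parcs T" by (auto simp: path_arcs_def)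
  then show ?thesis
    using crossing_arcs[OF path_props(1)[OF assms]] path_props[OF assms] by auto
qed

text \<open>For the converse, let \<open>v\<close> lie strictly below the top. It is not a common
  ancestor of both ends, so the path crosses the arc into \<open>v\<close>.\<close>

lemma set_path:
  assumes "i \<in> pverts T" "j \<in> pverts T"
  shows "v \<in> set (path i j) \<longleftrightarrow> anc (top i j) v \<and> (anc v i \<or> anc v j)"
proof -
  note pp = path_props[OF assms]
  note t = vpath_top[OF pp(1), folded top_def]
  show ?thesis
  proof
    assume v: "v \<in> set (path i j)"
    show "anc (top i j) v \<and> (anc v i \<or> anc v j)"
      using common_anc_vpath[OF pp(1) _ _ v, of "top i j"] vpath_anc_ends[OF pp(1) v] t pp by auto
  next
    assume v: "anc (top i j) v \<and> (anc v i \<or> anc v j)"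
    show "v \<in> set (path i j)"
    proof (cases "v = top i j")
      case False
      then obtain u where u: "(u, v) \<in> parcs T" using v by (metis rtranclE)
      have "anc v i \<noteq> anc v j"
        using anc_top[OF assms] anc_antisym v False by blast
      then show ?thesis using path_arcs_path[OF assms] path_arcs_verts[of u v T "path i j"] u by auto
    qed (use t in auto)
  qed
qed

text \<open>Cut the path at its top. By \<open>vpath_anc_ends\<close>, a vertex of either half lies
  above the top or above the outer end of that half, and the top itself lies above that end.\<close>

lemma sides_path:
  assumes "i \<in> pverts T" "j \<in> pverts T"
  shows "v \<in> start_side T (path i j) \<longleftrightarrow> anc (top i j) v \<and> anc v i" (is ?A)
    and "v \<in> end_side T (path i j) \<longleftrightarrow> anc (top i j) v \<and> anc v j" (is ?B)
proof -
  define t where "t = top i j"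
  define p where "p = path i j"
  note pp = path_props[OF assms, folded p_def]
  have tp: "trek_top T p = t" by (simp add: t_def top_def p_def)
  have ta: "anc t i" "anc t j" using top_anc assms by (auto simp: t_def)
  have "t \<in> set p" using vpath_top(1)[OF pp(1)] by (simp add: tp)
  then obtain xs ys where p: "p = xs @ t # ys" "t \<notin> set xs"
    by (meson split_list_first)
  have ty: "t \<notin> set ys" using pp(1) p by (auto simp: vpath_def)
  have tw: "takeWhile (\<lambda>v. v \<noteq> t) p = xs" "dropWhile (\<lambda>v. v \<noteq> t) p = t # ys"
    using p(2) unfolding p(1) by (auto simp: takeWhile_tail takeWhile_append dropWhile_append)
  have ss: "start_side T p = insert t (set xs)" "end_side T p = insert t (set ys)"
    unfolding start_side_def end_side_def tp by (simp_all add: tw)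
  have x: "anc v i" if "v \<in> set xs" for v
  proof -
    have "vpath (xs @ [t]) (mk_symmetric T)"
      using pp(1) p vpath_append_join[of "xs @ [t]" ys T] by (cases "ys = []") auto
    moreover have "hd (xs @ [t]) = i" using pp(2) that by (cases xs) (auto simp: p)
    ultimately show ?thesis
      using vpath_anc_ends[of "xs @ [t]" v] that ta by (auto intro: rtrancl_trans)
  qed
  have y: "anc v j" if "v \<in> set ys" for v
  proof -
    have "vpath (t # ys) (mk_symmetric T)"
      using pp(1) p vpath_append_join[of xs "t # ys" T] by (cases "xs = []") auto
    moreover have "last (t # ys) = j" using pp(3) that by (auto simp: p)
    ultimately show ?thesis
      using vpath_anc_ends[of "t # ys" v] that ta by (auto intro: rtrancl_trans)
  qed
  have sp: "v \<in> set p \<longleftrightarrow> anc t v \<and> (anc v i \<or> anc v j)" for v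
    using set_path[OF assms] by (simp add: p_def t_def)
  \<comment> \<open>A common ancestor of the ends on the path is the top, so any other vertex
    belongs to exactly one side.\<close>
  have c: "v = t" if "anc v i" "anc v j" "anc t v" for v
    using anc_top[OF assms that(1,2)] that(3) anc_antisym by (simp add: t_def)
  show ?A
    using ss(1) x y sp[of v] c[of v] ta p unfolding p_def[symmetric] t_def[symmetric] by auto
  show ?B
    using ss(2) x y sp[of v] c[of v] ta p unfolding p_def[symmetric] t_def[symmetric] by auto
qed

text \<open>In a tree, the condition on the sides in the definition of a choke point is automatic.\<close>

lemma choke_point_iff:
  assumes "i \<in> pverts T" "j \<in> pverts T" "k \<in> pverts T" "l \<in> pverts T"
  shows "choke_point T {i, j} {k, l} c \<longleftrightarrow>
    c \<in> set (path i k) \<and> c \<in> set (path i l) \<and> c \<in> set (path j k) \<and> c \<in> set (path j l)"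
    (is "_ \<longleftrightarrow> ?R")
proof -
  have V: "c \<in> pverts T" if ?R
    using that vpath_verts[OF path_props(1)[OF assms(1,3)]] by auto
  \<comment> \<open>By \<open>set_path\<close>, \<open>c\<close> lies above an end of each of the
    four paths. If it misses one of \<open>i\<close>, \<open>j\<close>, it must lie above both
    \<open>k\<close> and \<open>l\<close>. The two alternatives give the two choices of
    side.\<close>
  have anc: "?R \<Longrightarrow> anc c i \<and> anc c j \<or> anc c k \<and> anc c l"
    using assms set_path by metis
  show ?thesis
    unfolding choke_point_def using assms V anc
    by (auto simp: treks_eq sides_path set_path)
qed

end

section \<open>Monomial substitutions\<close>

definition expo :: "'x multiset \<Rightarrow> 'x \<Rightarrow>\<^sub>0 nat" where
  "expo M = (\<Sum>x\<in>#M. Poly_Mapping.single x 1)"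

definition mon :: "'x multiset \<Rightarrow> 'x cpoly" where
  "mon M = Poly_Mapping.single (expo M) 1"

lemma lookup_sum_mset: "Poly_Mapping.lookup (\<Sum>x\<in>#M. f x) a = (\<Sum>x\<in>#M. Poly_Mapping.lookup (f x) a)"
  by (induction M) (auto simp: lookup_add)

lemma lookup_expo: "Poly_Mapping.lookup (expo M) x = count M x"
  unfolding expo_def
  by (induction M) (auto simp: lookup_add lookup_single when_def)

lemma keys_expo: "Poly_Mapping.keys (expo M) = set_mset M"
  by (auto simp: in_keys_iff lookup_expo)

lemma ex_expo: "\<exists>M. expo M = m"
proof -
  have "finite {x. 0 < Poly_Mapping.lookup m x}"
    using finite_keys[of m] by (simp add: keys.rep_eq)
  then have "expo (Abs_multiset (Poly_Mapping.lookup m)) = m"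
    by (intro poly_mapping_eqI) (simp add: lookup_expo)
  then show ?thesis by blast
qed

lemma mon_empty: "mon {#} = 1"
  by (simp add: mon_def expo_def)

lemma mon_add_mset: "mon (add_mset x M) = Var x * mon M"
  by (simp add: mon_def expo_def Var_def mult_single)

lemma mon_closed: "set_mset M \<subseteq> X \<Longrightarrow> mon M \<in> carrier (poly_ring X)"
  by (simp add: mon_def carrier_poly_ring keys_expo)

lemma single_eq_mon: "Poly_Mapping.single (expo M) c = Const c * mon M"
  by (simp add: mon_def Const_def mult_single)

lemma poly_subst_mon:
  assumes "\<And>x. x \<in># M \<Longrightarrow> f x = Poly_Mapping.single (g x) 1"
  shows "poly_subst f (mon M) = Poly_Mapping.single (\<Sum>x\<in>#M. g x) 1"
  using assms
proof (induction M)
  case empty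
  show ?case by (simp add: mon_empty poly_subst_def Const_def)
qed (simp add: mon_add_mset poly_subst_mult mult_single)

lemma single_sum: "Poly_Mapping.single m (\<Sum>a\<in>A. c a) = (\<Sum>a\<in>A. Poly_Mapping.single m (c a))"
  by (induction A rule: infinite_finite_induct) (auto simp: single_add)

lemma
  assumes "ideal J (poly_ring X)"
  shows poly_ideal_zero: "0 \<in> J"
    and poly_ideal_add: "p \<in> J \<Longrightarrow> q \<in> J \<Longrightarrow> p + q \<in> J"
    and poly_ideal_mult: "p \<in> J \<Longrightarrow> q \<in> carrier (poly_ring X) \<Longrightarrow> q * p \<in> J"
proof -
  interpret J: ideal J "poly_ring X" by (rule assms)
  show "0 \<in> J" "p \<in> J \<Longrightarrow> q \<in> J \<Longrightarrow> p + q \<in> J"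
    "p \<in> J \<Longrightarrow> q \<in> carrier (poly_ring X) \<Longrightarrow> q * p \<in> J"
    using additive_subgroup.zero_closed[OF J.additive_subgroup_axioms]
      additive_subgroup.a_closed[OF J.additive_subgroup_axioms] J.I_l_closed
    by simp_all
qed

lemma poly_ideal_uminus:
  assumes "ideal J (poly_ring X)" "p \<in> J"
  shows "- p \<in> J"
  using poly_ideal_mult[OF assms poly_ring_uminus_closed[OF poly_ring_one_closed]] by simp

text \<open>Replace every monomial of \<open>p\<close> by a chosen representative of its fibre; the
  coefficients in each fibre then add up to zero.\<close>

lemma monomial_subst_kernel:
  fixes f :: "'x \<Rightarrow> 'y cpoly" and p :: "'x cpoly"
  assumes f: "\<And>x. x \<in> X \<Longrightarrow> f x = Poly_Mapping.single (g x) 1"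
    and J: "ideal J (poly_ring X)"
    and bin: "\<And>M N. \<lbrakk>set_mset M \<subseteq> X; set_mset N \<subseteq> X; (\<Sum>x\<in>#M. g x) = (\<Sum>x\<in>#N. g x)\<rbrakk>
      \<Longrightarrow> mon M - mon N \<in> J"
    and p: "p \<in> carrier (poly_ring X)" "poly_subst f p = 0"
  shows "p \<in> J"
proof -
  define E where "E = (\<lambda>M. \<Sum>x\<in>#M. g x)"
  define ms :: "('x \<Rightarrow>\<^sub>0 nat) \<Rightarrow> 'x multiset" where "ms = (\<lambda>m. SOME M. expo M = m)"
  define rep where "rep = (\<lambda>e. SOME M. set_mset M \<subseteq> X \<and> E M = e)"
  define c where "c = Poly_Mapping.lookup p"
  let ?K = "Poly_Mapping.keys p"
  have ms: "expo (ms m) = m" for m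
    unfolding ms_def using ex_expo[of m] by (rule someI_ex)
  have msX: "set_mset (ms m) \<subseteq> X" if "m \<in> ?K" for m
    using p(1) that ms[of m] keys_expo[of "ms m"] by (auto simp: carrier_poly_ring)
  have rep: "set_mset (rep (E (ms m))) \<subseteq> X \<and> E (rep (E (ms m))) = E (ms m)" if "m \<in> ?K" for m
    unfolding rep_def by (rule someI[of _ "ms m"]) (use msX[OF that] in simp)
  have pexp: "p = (\<Sum>m\<in>?K. Const (c m) * mon (ms m))"
    using cpoly_expansion[of p] by (simp add: c_def ms flip: single_eq_mon)
  have "poly_subst f p = (\<Sum>m\<in>?K. Poly_Mapping.single (E (ms m)) (c m))"
  proof (subst pexp, unfold poly_subst_sum, rule sum.cong[OF refl])
    fix m assume "m \<in> ?K"
    then have "poly_subst f (mon (ms m)) = Poly_Mapping.single (E (ms m)) 1"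
      unfolding E_def using msX f by (intro poly_subst_mon) auto
    then show "poly_subst f (Const (c m) * mon (ms m)) = Poly_Mapping.single (E (ms m)) (c m)"
      unfolding poly_subst_mult poly_subst_Const by (simp add: Const_def mult_single)
  qed
  then have z: "(\<Sum>m\<in>?K. Poly_Mapping.single (E (ms m)) (c m)) = 0" using p(2) by simp
  \<comment> \<open>Compare the coefficients of the monomial \<open>e\<close> in the vanishing image
    of \<open>p\<close>.\<close>
  have fib: "(\<Sum>m | m \<in> ?K \<and> E (ms m) = e. c m) = 0" for e
  proof -
    have "0 = Poly_Mapping.lookup (\<Sum>m\<in>?K. Poly_Mapping.single (E (ms m)) (c m)) e"
      by (simp add: z)
    also have "\<dots> = (\<Sum>m\<in>?K. if E (ms m) = e then c m else 0)"
      by (simp add: lookup_sum lookup_single when_def)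
    also have "\<dots> = (\<Sum>m | m \<in> ?K \<and> E (ms m) = e. c m)"
      by (simp add: sum.inter_filter)
    finally show ?thesis by simp
  qed
  have "(\<Sum>m\<in>?K. Const (c m) * mon (rep (E (ms m)))) =
      (\<Sum>e\<in>(\<lambda>m. E (ms m)) ` ?K. \<Sum>m | m \<in> ?K \<and> E (ms m) = e. Const (c m) * mon (rep (E (ms m))))"
    by (rule sum.image_gen) simp
  also have "\<dots> = (\<Sum>e\<in>(\<lambda>m. E (ms m)) ` ?K.
      Poly_Mapping.single (expo (rep e)) (\<Sum>m | m \<in> ?K \<and> E (ms m) = e. c m))"
    by (rule sum.cong[OF refl]) (simp add: single_sum single_eq_mon)
  also have "\<dots> = 0" by (simp add: fib)
  \<comment> \<open>The sum over the representatives vanishes, so it can be subtracted, leaving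
    differences to which \<open>bin\<close> applies.\<close>
  finally have "p = (\<Sum>m\<in>?K. Const (c m) * mon (ms m)) - (\<Sum>m\<in>?K. Const (c m) * mon (rep (E (ms m))))"
    using pexp by simp
  also have "\<dots> = (\<Sum>m\<in>?K. Const (c m) * (mon (ms m) - mon (rep (E (ms m)))))"
    by (simp add: sum_subtractf right_diff_distrib)
  also have "\<dots> \<in> J"
  proof -
    have t: "Const (c m) * (mon (ms m) - mon (rep (E (ms m)))) \<in> J" if "m \<in> ?K" for m
      using poly_ideal_mult[OF J bin Const_closed] msX[OF that] rep[OF that] by (simp add: E_def)
    have "(\<Sum>m\<in>A. Const (c m) * (mon (ms m) - mon (rep (E (ms m))))) \<in> J" if "A \<subseteq> ?K" for A
      using finite_subset[OF that finite_keys] that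
    proof (induction A rule: finite_induct)
      case empty
      then show ?case using poly_ideal_zero[OF J] by simp
    next
      case (insert x F)
      then show ?case using t poly_ideal_add[OF J] by simp
    qed
    then show ?thesis by simp
  qed
  finally show ?thesis .
qed

lemma prod_Var:
  "finite A \<Longrightarrow> (\<Prod>a\<in>A. Var (h a)) = Poly_Mapping.single (\<Sum>a\<in>A. Poly_Mapping.single (h a) 1) 1"
  by (induction A rule: finite_induct) (auto simp: Var_def mult_single)

lemma single_one_inject:
  "Poly_Mapping.single m (1::complex) = Poly_Mapping.single m' 1 \<longleftrightarrow> m = m'"
  by (metis keys_single one_neq_zero singleton_inject)

lemma poly_ring_minus_closed:
  assumes "p \<in> carrier (poly_ring X)" "q \<in> carrier (poly_ring X)"
  shows "p - q \<in> carrier (poly_ring X)"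
  using poly_ring_add_closed[OF assms(1) poly_ring_uminus_closed[OF assms(2)]] by simp

lemma Upair_commute: "Upair i j = Upair j i"
  by simp

section \<open>Exchanging the ends of paths\<close>

context rooted_directed_tree
begin

lemma leaves_verts: "i \<in> leaves T \<Longrightarrow> i \<in> pverts T"
  by (simp add: leaves_def)

lemma leaf_anc: "i \<in> leaves T \<Longrightarrow> anc i x \<Longrightarrow> x = i"
proof (rule ccontr)
  assume i: "i \<in> leaves T" "anc i x" "x \<noteq> i"
  then obtain w where "(i, w) \<in> parcs T" using anc_child by blast
  then have "out_arcs T i \<noteq> {}" by (force simp: out_arcs_def)
  moreover have "finite (out_arcs T i)" by blast
  ultimately have "out_degree T i \<noteq> 0" unfolding out_degree_def by auto
  then show False using i by (simp add: leaves_def)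
qed

section \<open>Exponent vectors of the images of the variables\<close>

lemma finite_path_arcs: "finite (path_arcs T p)"
  by (rule finite_subset[OF _ pair_finite_arcs]) (auto simp: path_arcs_def)

text \<open>The description is meaningful for pairs of vertices, where the single trek makes the
  image a monomial.\<close>

definition texp :: "'v uprod \<Rightarrow> 'v param \<Rightarrow>\<^sub>0 nat" where
  "texp x = (THE m. sigma_image T x = Poly_Mapping.single m 1)"

lemma
  assumes "i \<in> pverts T" "j \<in> pverts T"
  shows sigma_image_texp: "sigma_image T (Upair i j) = Poly_Mapping.single (texp (Upair i j)) 1"
    and lookup_texp_A: "Poly_Mapping.lookup (texp (Upair i j)) (A_par v) = of_bool (top i j = v)"
    and lookup_texp_Lambda: "Poly_Mapping.lookup (texp (Upair i j)) (Lambda_par (u, w)) =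
      of_bool ((u, w) \<in> parcs T \<and> anc w i \<noteq> anc w j)"
proof -
  let ?m = "Poly_Mapping.single (A_par (top i j)) 1 +
    (\<Sum>e\<in>path_arcs T (path i j). Poly_Mapping.single (Lambda_par e) (1::nat))"
  have "sigma_image T (Upair i j) = trek_sum T i j"
    by (simp add: sigma_image.abs_eq Upair.abs_eq)
  also have "\<dots> = Var (A_par (top i j)) * (\<Prod>e\<in>path_arcs T (path i j). Var (Lambda_par e))"
    using assms by (simp add: trek_sum_def treks_eq top_def)
  also have "\<dots> = Poly_Mapping.single ?m 1"
    by (simp add: prod_Var[OF finite_path_arcs] Var_def[of "A_par _"] mult_single)
  finally have 1: "sigma_image T (Upair i j) = Poly_Mapping.single ?m 1" .
  then have 2: "texp (Upair i j) = ?m"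
    unfolding texp_def by (simp add: single_one_inject)
  show "sigma_image T (Upair i j) = Poly_Mapping.single (texp (Upair i j)) 1"
    using 1 2 by simp
  show "Poly_Mapping.lookup (texp (Upair i j)) (A_par v) = of_bool (top i j = v)"
    by (simp add: 2 lookup_add lookup_sum lookup_single when_def)
  show "Poly_Mapping.lookup (texp (Upair i j)) (Lambda_par (u, w)) =
      of_bool ((u, w) \<in> parcs T \<and> anc w i \<noteq> anc w j)"
    using assms finite_path_arcs[of "path i j"]
    by (simp add: 2 lookup_add lookup_sum lookup_single when_def path_arcs_path)
qed

text \<open>Here \<open>c\<close> lies between \<open>i\<close> and the top, so \<open>i\<close> and
  \<open>c\<close> have the same common ancestors with \<open>k\<close>.\<close>

lemma top_through:
  assumes "i \<in> pverts T" "k \<in> pverts T" "c \<in> set (path i k)" "anc c i"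
  shows "top i k = top c k"
proof -
  have "c \<in> pverts T" using assms anc_verts by blast
  then show ?thesis
    using assms top_anc set_path by (intro top_eqI[symmetric]) (auto intro: anc_top rtrancl_trans)
qed

text \<open>A path through \<open>c\<close> is the path to \<open>c\<close> followed by the path
  from \<open>c\<close>, and the two share no arc.\<close>

lemma crossing_through:
  assumes "i \<in> pverts T" "k \<in> pverts T" "c \<in> set (path i k)"
  shows "(of_bool (anc w i \<noteq> anc w k) :: nat) =
    of_bool (anc w i \<noteq> anc w c) + of_bool (anc w c \<noteq> anc w k)"
proof -
  have "anc (top i k) c" "anc c i \<or> anc c k" using assms set_path by auto
  then have "anc w i \<and> anc w k \<Longrightarrow> anc w c" "anc w c \<Longrightarrow> anc w i \<or> anc w k"
    using anc_top[OF assms(1,2), of w] by (auto intro: rtrancl_trans)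
  then show ?thesis by auto
qed

text \<open>All four paths split at \<open>c\<close>, and both sides of the equation collect the
  same four halves.\<close>

lemma texp_choke:
  assumes "i \<in> pverts T" "j \<in> pverts T" "k \<in> pverts T" "l \<in> pverts T"
    and "choke_point T {i, j} {k, l} c"
  shows "texp (Upair i k) + texp (Upair j l) = texp (Upair i l) + texp (Upair k j)"
proof (rule poly_mapping_eqI)
  have c: "c \<in> set (path i k)" "c \<in> set (path i l)" "c \<in> set (path j k)" "c \<in> set (path j l)"
    using assms choke_point_iff by auto
  have cV: "c \<in> pverts T" using c assms vpath_verts[OF path_props(1)] by blast
  have cr: "c \<in> set (path k i)" "c \<in> set (path l i)" "c \<in> set (path k j)" "c \<in> set (path l j)"
    using c assms set_path top_commute by auto
  fix x :: "'v param"
  show "Poly_Mapping.lookup (texp (Upair i k) + texp (Upair j l)) x =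
      Poly_Mapping.lookup (texp (Upair i l) + texp (Upair k j)) x"
  proof (cases x)
    case (A_par v)
    have "anc c i \<and> anc c j \<or> anc c k \<and> anc c l" using c assms set_path by metis
    \<comment> \<open>If \<open>c\<close> lies above \<open>i\<close> and \<open>j\<close>, both may
      be replaced by \<open>c\<close> without changing a top; likewise for \<open>k\<close> and
      \<open>l\<close>.\<close>
    then have "top i k = top j k \<and> top i l = top j l \<or> top i k = top i l \<and> top j k = top j l"
      using top_through assms c cr top_commute by metis
    then show ?thesis using assms by (auto simp: A_par lookup_add lookup_texp_A top_commute[of k j])
  next
    case (Lambda_par e)
    obtain u w where e: "e = (u, w)" by fastforce
    show ?thesis
    proof (cases "(u, w) \<in> parcs T")
      case True
      define d where "d = (\<lambda>a b. of_bool (anc w a \<noteq> anc w b) :: nat)"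
      have "d i k = d i c + d c k" "d j l = d j c + d c l" "d i l = d i c + d c l" "d k j = d k c + d c j"
        unfolding d_def using crossing_through assms c cr by blast+
      moreover have "d k c = d c k" "d c j = d j c" by (auto simp: d_def)
      ultimately have "d i k + d j l = d i l + d k j" by simp
      then show ?thesis
        using assms True by (simp add: Lambda_par e lookup_add lookup_texp_Lambda d_def)
    next
      case False
      then show ?thesis using assms by (simp add: Lambda_par e lookup_add lookup_texp_Lambda)
    qed
  qed
qed

text \<open>Deleting a vertex \<open>v\<close> disconnects the tree; \<open>port v\<close> names the component that contains a given
  vertex, with \<^const>\<open>None\<close> for the component above \<open>v\<close>.\<close>

definition port :: "'v \<Rightarrow> 'v \<Rightarrow> 'v option" where
  "port v i = (if anc v i then Some (THE w. (v, w) \<in> parcs T \<and> anc w i) else None)"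

text \<open>At \<open>i = v\<close> no child of \<open>v\<close> lies above \<open>i\<close>, and
  the \<open>THE\<close> in \<open>port\<close> would be arbitrary; hence the assumption.\<close>

lemma port_eq_Some:
  assumes "i \<noteq> v"
  shows "port v i = Some w \<longleftrightarrow> (v, w) \<in> parcs T \<and> anc w i"
proof (cases "anc v i")
  case True
  then have "\<exists>!w. (v, w) \<in> parcs T \<and> anc w i"
    using anc_child[of v i] child_unique assms by blast
  from theI'[OF this] show ?thesis using True child_unique by (auto simp: port_def)
next
  case False
  then show ?thesis by (auto simp: port_def intro: converse_rtrancl_into_rtrancl)
qed

lemma port_eq_None: "port v i = None \<longleftrightarrow> \<not> anc v i"
  by (simp add: port_def)

text \<open>Equal ports put both ends under one child of \<open>v\<close>, or both outside the
  subtree of \<open>v\<close>, and the path avoids \<open>v\<close>. If the top is not above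
  \<open>v\<close> while an end is below \<open>v\<close>, the top is strictly below
  \<open>v\<close> and both ends share its port.\<close>

lemma in_path_iff_port:
  assumes "i \<in> pverts T" "j \<in> pverts T" "i \<noteq> v" "j \<noteq> v"
  shows "v \<in> set (path i j) \<longleftrightarrow> port v i \<noteq> port v j"
proof
  assume v: "v \<in> set (path i j)"
  show "port v i \<noteq> port v j"
  proof
    assume eq: "port v i = port v j"
    show False
    proof (cases "port v i")
      case None
      then have "\<not> anc v i" "\<not> anc v j" using eq port_eq_None by metis+
      then show False using v assms set_path by auto
    next
      case (Some w)
      then have w: "(v, w) \<in> parcs T" "anc w i" "anc w j"
        using eq assms port_eq_Some by metis+
      then have "anc w v" using v anc_top[of i j w] assms set_path by (auto intro: rtrancl_trans)
      then show False using w child_not_anc by blast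
    qed
  qed
next
  assume ne: "port v i \<noteq> port v j"
  have t: "anc (top i j) i" "anc (top i j) j" using top_anc assms by auto
  have a: "anc v i \<or> anc v j" using ne port_eq_None by metis
  have "anc (top i j) v"
  proof (rule ccontr)
    assume n: "\<not> anc (top i j) v"
    then have "anc v (top i j)" "v \<noteq> top i j" using a t anc_chain by auto
    then obtain w where "(v, w) \<in> parcs T" "anc w (top i j)" using anc_child by blast
    then have "port v i = Some w" "port v j = Some w"
      using t assms by (auto simp: port_eq_Some intro: rtrancl_trans)
    then show False using ne by simp
  qed
  then show "v \<in> set (path i j)" using a assms set_path by auto
qed

section \<open>The tetrad ideal and the easy inclusion\<close>

definition leaf_pairs :: "'v uprod set" where
  "leaf_pairs = {Upair i j | i j. i \<in> leaves T \<and> j \<in> leaves T}"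

lemma sigma_ring_leaves: "sigma_ring (leaves T) = poly_ring leaf_pairs"
  by (simp add: sigma_ring_def leaf_pairs_def)

lemma Upair_in_leaf_pairs [simp]: "Upair i j \<in> leaf_pairs \<longleftrightarrow> i \<in> leaves T \<and> j \<in> leaves T"
  by (auto simp: leaf_pairs_def)

definition tetrads :: "'v uprod cpoly set" where
  "tetrads = {sigma i k * sigma j l - sigma i l * sigma k j | i j k l.
     {i, j, k, l} \<subseteq> leaves T \<and> (\<exists>c. choke_point T {i, j} {k, l} c)}"

definition tetrad_ideal :: "'v uprod cpoly set" where
  "tetrad_ideal = Idl\<^bsub>poly_ring leaf_pairs\<^esub> tetrads"

lemma tetrads_closed: "tetrads \<subseteq> carrier (poly_ring leaf_pairs)"
  unfolding tetrads_def
  by (auto intro!: poly_ring_minus_closed poly_ring_mult_closed Var_closed)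

lemma ideal_tetrad_ideal: "ideal tetrad_ideal (poly_ring leaf_pairs)"
  unfolding tetrad_ideal_def
  by (rule ring.genideal_ideal[OF cring.axioms(1)[OF cring_poly_ring] tetrads_closed])

lemma phi_mon:
  assumes "set_mset M \<subseteq> leaf_pairs"
  shows "phi T (mon M) = Poly_Mapping.single (\<Sum>x\<in>#M. texp x) 1"
  unfolding phi_def
  using assms by (intro poly_subst_mon) (auto simp: leaf_pairs_def sigma_image_texp leaves_verts)

lemma sigma_image_closed:
  assumes "x \<in> leaf_pairs"
  shows "sigma_image T x \<in> carrier (poly_ring (params T))"
proof -
  obtain i j where "x = Upair i j" "i \<in> leaves T" "j \<in> leaves T"
    using assms unfolding leaf_pairs_def by blast
  then have x: "x = Upair i j" "i \<in> pverts T" "j \<in> pverts T" by (simp_all add: leaves_verts)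
  have "top i j \<in> pverts T" using top_anc[OF x(2,3)] anc_verts x by blast
  moreover have "path_arcs T (path i j) \<subseteq> parcs T" by (auto simp: path_arcs_def)
  ultimately have "trek_sum T i j \<in> carrier (poly_ring (params T))"
    unfolding trek_sum_def treks_eq[OF x(2,3)]
    by (auto simp: params_def top_def intro!: poly_ring_mult_closed poly_ring_prod_closed Var_closed)
  then show ?thesis by (simp add: x sigma_image.abs_eq Upair.abs_eq)
qed

lemma phi_ring_hom: "phi T \<in> ring_hom (poly_ring leaf_pairs) (poly_ring (params T))"
  unfolding phi_def by (rule poly_subst_ring_hom) (rule sigma_image_closed)

text \<open>The leaf ring is contained in the ring on all vertices, so the intersection is the
  kernel of the restriction of \<open>phi\<close>.\<close>

lemma observed_trek_ideal_leaves:
  "observed_trek_ideal T (leaves T) = a_kernel (poly_ring leaf_pairs) (poly_ring (params T)) (phi T)"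
proof -
  have "carrier (poly_ring leaf_pairs) \<subseteq> carrier (sigma_ring (pverts T))"
    unfolding sigma_ring_def carrier_poly_ring subset_iff leaf_pairs_def
    using leaves_verts by blast
  then show ?thesis
    unfolding observed_trek_ideal_def trek_ideal_def sigma_ring_leaves
    by (auto simp: a_kernel_def kernel_def)
qed

lemma observed_trek_ideal_iff:
  "p \<in> observed_trek_ideal T (leaves T) \<longleftrightarrow> p \<in> carrier (poly_ring leaf_pairs) \<and> phi T p = 0"
  by (simp add: observed_trek_ideal_leaves a_kernel_def kernel_def)

lemma phi_diff: "phi T (p - q) = phi T p - phi T q"
proof -
  have "phi T (p - q) + phi T q = phi T (p - q + q)" unfolding phi_def by (simp only: poly_subst_add)
  then show ?thesis by (simp add: eq_diff_eq)
qed

lemma tetrad_ideal_subset: "tetrad_ideal \<subseteq> observed_trek_ideal T (leaves T)"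
  unfolding tetrad_ideal_def
proof (rule ring.genideal_minimal[OF cring.axioms(1)[OF cring_poly_ring]])
  interpret ring_hom_ring "poly_ring leaf_pairs" "poly_ring (params T)" "phi T"
    by (intro ring_hom_ringI2 cring.axioms(1) cring_poly_ring phi_ring_hom)
  show "ideal (observed_trek_ideal T (leaves T)) (poly_ring leaf_pairs)"
    unfolding observed_trek_ideal_leaves by (rule kernel_is_ideal)
  show "tetrads \<subseteq> observed_trek_ideal T (leaves T)"
  proof
    fix p assume p: "p \<in> tetrads"
    then obtain i j k l c where q: "p = sigma i k * sigma j l - sigma i l * sigma k j"
      "{i, j, k, l} \<subseteq> leaves T" "choke_point T {i, j} {k, l} c"
      unfolding tetrads_def by blast
    have "phi T p = phi T (mon {#Upair i k, Upair j l#} - mon {#Upair i l, Upair k j#})"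
      by (simp add: q mon_add_mset mon_empty)
    also have "\<dots> = 0"
      using q(2) texp_choke[OF _ _ _ _ q(3)] unfolding phi_diff by (simp add: phi_mon leaves_verts)
    finally show "p \<in> observed_trek_ideal T (leaves T)"
      using p tetrads_closed observed_trek_ideal_iff by blast
  qed
qed

section \<open>Congruence of monomials modulo tetrads\<close>

abbreviation total_texp :: "'v uprod multiset \<Rightarrow> 'v param \<Rightarrow>\<^sub>0 nat" where
  "total_texp M \<equiv> \<Sum>x\<in>#M. texp x"

definition tetrad_congr :: "'v uprod multiset \<Rightarrow> 'v uprod multiset \<Rightarrow> bool" where
  "tetrad_congr M N \<longleftrightarrow> set_mset M \<subseteq> leaf_pairs \<and> set_mset N \<subseteq> leaf_pairs \<and> mon M - mon N \<in> tetrad_ideal"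

lemma tetrad_congr_refl: "set_mset M \<subseteq> leaf_pairs \<Longrightarrow> tetrad_congr M M"
  by (simp add: tetrad_congr_def poly_ideal_zero[OF ideal_tetrad_ideal])

lemma tetrad_congr_sym: "tetrad_congr M N \<Longrightarrow> tetrad_congr N M"
  using poly_ideal_uminus[OF ideal_tetrad_ideal] by (fastforce simp: tetrad_congr_def)

lemma tetrad_congr_trans: "tetrad_congr M N \<Longrightarrow> tetrad_congr N K \<Longrightarrow> tetrad_congr M K"
  using poly_ideal_add[OF ideal_tetrad_ideal, of "mon M - mon N" "mon N - mon K"]
  by (auto simp: tetrad_congr_def)

lemma tetrad_congr_add_mset: "tetrad_congr M N \<Longrightarrow> x \<in> leaf_pairs \<Longrightarrow> tetrad_congr (add_mset x M) (add_mset x N)"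
  using poly_ideal_mult[OF ideal_tetrad_ideal, of "mon M - mon N" "Var x"]
    Var_closed[of x leaf_pairs]
  by (auto simp: tetrad_congr_def mon_add_mset right_diff_distrib)

text \<open>By the easy inclusion, \<open>phi\<close> kills the difference, and both images are
  monomials.\<close>

lemma tetrad_congr_total_texp:
  assumes "tetrad_congr M N"
  shows "total_texp M = total_texp N"
proof -
  have "phi T (mon M) - phi T (mon N) = 0"
    using assms tetrad_ideal_subset observed_trek_ideal_iff unfolding tetrad_congr_def
    by (metis phi_diff subsetD)
  then show ?thesis using assms by (simp add: tetrad_congr_def phi_mon single_one_inject)
qed

text \<open>The four conditions on ports put \<open>v\<close> on all four paths, which makes it a
  choke point. The resulting tetrad is multiplied by \<open>mon K\<close>.\<close>

lemma tetrad_congr_swap: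
  assumes "i \<in> leaves T" "j \<in> leaves T" "k \<in> leaves T" "l \<in> leaves T" "v \<notin> leaves T"
    and "port v i \<noteq> port v k" "port v j \<noteq> port v l" "port v i \<noteq> port v l" "port v j \<noteq> port v k"
    and "set_mset K \<subseteq> leaf_pairs"
  shows "tetrad_congr (add_mset (Upair i k) (add_mset (Upair j l) K))
    (add_mset (Upair i l) (add_mset (Upair k j) K))"
proof -
  have "i \<noteq> v" "j \<noteq> v" "k \<noteq> v" "l \<noteq> v" using assms by auto
  then have "choke_point T {i, j} {k, l} v"
    using assms by (simp add: choke_point_iff in_path_iff_port leaves_verts)
  then have "sigma i k * sigma j l - sigma i l * sigma k j \<in> tetrads"
    using assms unfolding tetrads_def by blast
  then have "sigma i k * sigma j l - sigma i l * sigma k j \<in> tetrad_ideal"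
    using ring.genideal_self[OF cring.axioms(1)[OF cring_poly_ring] tetrads_closed]
    unfolding tetrad_ideal_def by blast
  from poly_ideal_mult[OF ideal_tetrad_ideal this mon_closed[OF assms(10)]]
  show ?thesis
    using assms by (simp add: tetrad_congr_def mon_add_mset algebra_simps)
qed

text \<open>The sum has one term, or none at the root.\<close>

definition through :: "'v \<Rightarrow> ('v param \<Rightarrow>\<^sub>0 nat) \<Rightarrow> nat" where
  "through v e = Poly_Mapping.lookup e (A_par v) +
    (\<Sum>u | (u, v) \<in> parcs T. Poly_Mapping.lookup e (Lambda_par (u, v)))"

lemma through_total_texp: "through v (total_texp M) = (\<Sum>x\<in>#M. through v (texp x))"
  by (induction M) (auto simp: through_def lookup_add sum.distrib)

text \<open>A vertex of a path is either its top or entered from its parent in the direction of the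
  arc, never both.\<close>

lemma through_texp:
  assumes "i \<in> pverts T" "j \<in> pverts T"
  shows "through v (texp (Upair i j)) = of_bool (v \<in> set (path i j))"
proof (cases "\<exists>u. (u, v) \<in> parcs T")
  case True
  then obtain u where u: "(u, v) \<in> parcs T" by blast
  then have "{u. (u, v) \<in> parcs T} = {u}" using parent_unique by blast
  then have 1: "through v (texp (Upair i j)) = of_bool (top i j = v) + of_bool (anc v i \<noteq> anc v j)"
    using u assms by (simp add: through_def lookup_texp_A lookup_texp_Lambda)
  have 2: "top i j = v \<Longrightarrow> anc v i \<and> anc v j" using top_anc assms by blast
  have 3: "v \<in> set (path i j)" if "anc v i \<noteq> anc v j"
    using path_arcs_path[OF assms] that u path_arcs_verts[of u v T "path i j"] by blast
  have 4: "anc v i \<noteq> anc v j" if "v \<in> set (path i j)" "top i j \<noteq> v"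
    using that set_path[OF assms] anc_top[OF assms] anc_antisym by metis
  show ?thesis
  proof (cases "top i j = v")
    case True
    moreover have "v \<in> set (path i j)" using set_path[OF assms, of v] 2 True by simp
    ultimately show ?thesis using 1 2 by simp
  next
    case False
    then have "v \<in> set (path i j) \<longleftrightarrow> anc v i \<noteq> anc v j" using 3 4 by blast
    then show ?thesis using 1 False by simp
  qed
next
  case False
  then have "anc (top i j) v \<longleftrightarrow> top i j = v" by (metis rtrancl.rtrancl_refl rtranclE)
  moreover have "through v (texp (Upair i j)) = of_bool (top i j = v)"
    using False assms by (simp add: through_def lookup_texp_A)
  ultimately show ?thesis using set_path[OF assms] top_anc[OF assms] by auto
qed

section \<open>Producing a prescribed pair by tetrad moves\<close>

lemma total_texp_pos:
  assumes "total_texp M = total_texp N" "x \<in># M" "Poly_Mapping.lookup (texp x) a \<noteq> 0"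
  obtains y where "y \<in># N" "Poly_Mapping.lookup (texp y) a \<noteq> 0"
proof -
  \<comment> \<open>Exponents are natural numbers, so nothing cancels in the sum.\<close>
  have "Poly_Mapping.lookup (total_texp M) a \<noteq> 0"
    using assms(2,3) by (auto simp: lookup_sum_mset)
  then have "Poly_Mapping.lookup (total_texp N) a \<noteq> 0" using assms(1) by simp
  then show ?thesis using that by (auto simp: lookup_sum_mset)
qed

text \<open>\<open>M\<close> uses the arc into the leaf \<open>i\<close>, so \<open>N\<close> does
  too, and only a pair containing \<open>i\<close> can. The top of that pair is also a top in
  \<open>M\<close>, hence not deeper than \<open>top i k\<close>. Both tops lie above
  \<open>i\<close>, so it lies above \<open>top i k\<close>.\<close>

lemma pair_path_through_top:
  assumes eq: "total_texp M = total_texp N" and "set_mset N \<subseteq> leaf_pairs"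
    and ik: "Upair i k \<in># M" "i \<in> leaves T" "k \<in> leaves T" "i \<noteq> k"
    and deep: "\<And>p q. \<lbrakk>Upair p q \<in># M; p \<in> leaves T; q \<in> leaves T\<rbrakk> \<Longrightarrow> depth (top p q) \<le> depth (top i k)"
    and M: "set_mset M \<subseteq> leaf_pairs"
  obtains x where "Upair i x \<in># N" "x \<in> leaves T" "top i k \<in> set (path i x)"
proof -
  have V: "i \<in> pverts T" "k \<in> pverts T" using ik leaves_verts by auto
  define v where "v = top i k"
  have v: "anc v i" "anc v k" using top_anc[OF V] by (auto simp: v_def)
  have "i \<noteq> v" using v ik leaf_anc by blast
  then obtain u where u: "(u, i) \<in> parcs T" using v by (metis rtranclE)
  have "\<not> anc i k" using ik leaf_anc by blast
  then have "Poly_Mapping.lookup (texp (Upair i k)) (Lambda_par (u, i)) \<noteq> 0"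
    using u V by (simp add: lookup_texp_Lambda)
  then obtain y where y: "y \<in># N" "Poly_Mapping.lookup (texp y) (Lambda_par (u, i)) \<noteq> 0"
    using total_texp_pos[OF eq ik(1)] by blast
  then obtain p q where pq: "y = Upair p q" "p \<in> leaves T" "q \<in> leaves T"
    using assms(2) unfolding leaf_pairs_def by blast
  have "anc i p \<noteq> anc i q"
    using y(2) pq by (simp add: lookup_texp_Lambda leaves_verts split: if_splits)
  then have "i = p \<or> i = q" using leaf_anc[OF ik(2)] by blast
  then obtain x where x: "Upair i x \<in># N" "x \<in> leaves T"
    using y(1) pq Upair_commute by metis
  have xV: "x \<in> pverts T" using x leaves_verts by auto
  have "Poly_Mapping.lookup (texp (Upair i x)) (A_par (top i x)) \<noteq> 0"
    using V xV by (simp add: lookup_texp_A)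
  then obtain z where z: "z \<in># M" "Poly_Mapping.lookup (texp z) (A_par (top i x)) \<noteq> 0"
    using total_texp_pos[OF eq[symmetric] x(1)] by blast
  then obtain p q where pq: "z = Upair p q" "p \<in> leaves T" "q \<in> leaves T"
    using M unfolding leaf_pairs_def by blast
  then have "top p q = top i x" using z(2) by (simp add: lookup_texp_A leaves_verts)
  then have d: "depth (top i x) \<le> depth v" using deep pq z(1) by (metis v_def)
  have ti: "anc (top i x) i" using top_anc[OF V(1) xV] by simp
  have "anc (top i x) v"
  proof (rule ccontr)
    assume n: "\<not> anc (top i x) v"
    then have "anc v (top i x)" "v \<noteq> top i x" using anc_chain ti v by auto
    moreover have "top i x \<in> pverts T" using ti V anc_verts by blast
    ultimately show False using depth_mono d by fastforce
  qed
  then show ?thesis using that x set_path[OF V(1) xV] v by (auto simp: v_def)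
qed

text \<open>The pairs of \<open>N\<close> that contain \<open>i\<close> and \<open>k\<close> run through the deepest top \<open>v\<close>, and can be
  recombined unless they leave \<open>v\<close> through the same port. In that case, counting shows that some
  pair of \<open>N\<close> runs through \<open>v\<close> avoiding this port, and one prior move with this pair helps.\<close>

lemma tetrad_congr_produce_pair:
  assumes eq: "total_texp M = total_texp N"
    and M: "set_mset M \<subseteq> leaf_pairs" and N: "set_mset N \<subseteq> leaf_pairs"
    and ik: "Upair i k \<in># M" "i \<in> leaves T" "k \<in> leaves T" "i \<noteq> k"
    and deep: "\<And>p q. \<lbrakk>Upair p q \<in># M; p \<in> leaves T; q \<in> leaves T\<rbrakk> \<Longrightarrow> depth (top p q) \<le> depth (top i k)"
  shows "\<exists>N'. tetrad_congr N N' \<and> Upair i k \<in># N'"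
proof (cases "Upair i k \<in># N")
  case True
  then show ?thesis using tetrad_congr_refl N by blast
next
  case notin: False
  define v where "v = top i k"
  have V: "i \<in> pverts T" "k \<in> pverts T" using ik leaves_verts by auto
  have vanc: "anc v i" "anc v k" using top_anc[OF V] by (auto simp: v_def)
  have vleaf: "v \<notin> leaves T" using vanc ik(4) leaf_anc by blast
  then have lv: "p \<noteq> v" if "p \<in> leaves T" for p using that by blast
  have thr: "v \<in> set (path p q) \<longleftrightarrow> port v p \<noteq> port v q" if "p \<in> leaves T" "q \<in> leaves T" for p q
    using in_path_iff_port that lv leaves_verts by blast
  obtain x where x: "Upair i x \<in># N" "x \<in> leaves T" "v \<in> set (path i x)"
    using pair_path_through_top[OF eq N ik deep M] v_def by blast
  obtain y where y: "Upair k y \<in># N" "y \<in> leaves T" "v \<in> set (path k y)"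
  proof -
    have "depth (top p q) \<le> depth (top k i)"
      if "Upair p q \<in># M" "p \<in> leaves T" "q \<in> leaves T" for p q
      using deep[OF that] top_commute V by simp
    moreover have "Upair k i \<in># M" using ik(1) Upair_commute by metis
    ultimately show thesis
      using pair_path_through_top[OF eq N _ ik(3,2) ik(4)[symmetric] _ M, of thesis] that top_commute[OF V]
      by (auto simp: v_def)
  qed
  \<comment> \<open>Equality would force \<open>x = k\<close> and put the pair
    \<open>Upair i k\<close> into \<open>N\<close>. As the pairs differ, both can be removed from
    \<open>N\<close>.\<close>
  have "Upair i x \<noteq> Upair k y" using ik(4) notin x by auto
  then obtain N0 where N0: "N = add_mset (Upair i x) (add_mset (Upair k y) N0)"
    using x(1) y(1) by (metis insert_noteq_member mset_add)
  have N0L: "set_mset N0 \<subseteq> leaf_pairs" using N N0 by auto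
  have pik: "port v i \<noteq> port v k" using thr[OF ik(2,3)] set_path[OF V] vanc by (simp add: v_def)
  have pix: "port v i \<noteq> port v x" and pky: "port v k \<noteq> port v y"
    using thr x y ik by auto
  show ?thesis
  proof (cases "port v x = port v y")
    case False
    have "tetrad_congr (add_mset (Upair i x) (add_mset (Upair y k) N0))
        (add_mset (Upair i k) (add_mset (Upair x y) N0))"
      using x y ik vleaf pix pky pik False N0L by (intro tetrad_congr_swap) auto
    then have "tetrad_congr N (add_mset (Upair i k) (add_mset (Upair x y) N0))"
      by (simp only: N0 Upair_commute[of k y])
    then show ?thesis by (intro exI conjI) auto
  next
    case same: True
    have "\<exists>p q. Upair p q \<in># N \<and> p \<in> leaves T \<and> q \<in> leaves T \<and>
      port v p \<noteq> port v q \<and> port v p \<noteq> port v x \<and> port v q \<noteq> port v x"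
    proof (rule ccontr)
      assume nex: "\<not> ?thesis"
      then have all: "port v p = port v x \<or> port v q = port v x"
        if "Upair p q \<in># N" "p \<in> leaves T" "q \<in> leaves T" "v \<in> set (path p q)" for p q
        using that thr[OF that(2,3)] nex by blast
      show False
      proof (cases "port v x")
        case None
        \<comment> \<open>The shared port leads upwards. Some pair of \<open>N\<close> has top
          \<open>v\<close>, and both of its ends lie below \<open>v\<close>, avoiding that
          port.\<close>
        have "Poly_Mapping.lookup (texp (Upair i k)) (A_par v) \<noteq> 0"
          using V by (simp add: lookup_texp_A v_def)
        then obtain z where z: "z \<in># N" "Poly_Mapping.lookup (texp z) (A_par v) \<noteq> 0"
          using total_texp_pos[OF eq ik(1)] by blast
        then obtain p q where pq: "z = Upair p q" "p \<in> leaves T" "q \<in> leaves T"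
          using N unfolding leaf_pairs_def by blast
        then have t: "top p q = v" using z(2) by (simp add: lookup_texp_A leaves_verts)
        then have "anc v p" "anc v q" using top_anc pq leaves_verts by blast+
        moreover from this have "v \<in> set (path p q)"
          using t pq set_path leaves_verts by auto
        ultimately show False
          using all[of p q] z(1) pq None port_eq_None by auto
      next
        case (Some d)
        have d: "(v, d) \<in> parcs T" using Some lv[OF x(2)] port_eq_Some by blast
        have pd: "anc d p \<longleftrightarrow> port v p = Some d" if "p \<in> leaves T" for p
          using port_eq_Some[OF lv[OF that]] d by blast
        \<comment> \<open>\<open>?c\<close> counts uses of the arc from \<open>v\<close> to
          \<open>d\<close>. Any path using it visits \<open>v\<close>; by \<open>all\<close>, every
          path of \<open>N\<close> that visits \<open>v\<close> uses it. The pair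
          \<open>Upair i k\<close> of \<open>M\<close> visits \<open>v\<close> without using it, so
          the totals of \<open>M\<close> and \<open>N\<close> cannot agree.\<close>
        let ?c = "\<lambda>z. Poly_Mapping.lookup (texp z) (Lambda_par (v, d))"
        have c: "?c (Upair p q) = of_bool ((port v p = Some d) \<noteq> (port v q = Some d))"
          if "p \<in> leaves T" "q \<in> leaves T" for p q
          using that d pd by (simp add: lookup_texp_Lambda leaves_verts)
        have t: "through v (texp (Upair p q)) = of_bool (port v p \<noteq> port v q)"
          if "p \<in> leaves T" "q \<in> leaves T" for p q
          using that thr by (simp add: through_texp leaves_verts)
        have le1: "?c z \<le> through v (texp z)" if "z \<in># M" for z
        proof -
          obtain p q where "z = Upair p q" "p \<in> leaves T" "q \<in> leaves T"
            using \<open>z \<in># M\<close> M unfolding leaf_pairs_def by blast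
          then show ?thesis using c t by auto
        qed
        have le2: "through v (texp z) \<le> ?c z" if "z \<in># N" for z
        proof -
          obtain p q where "z = Upair p q" "p \<in> leaves T" "q \<in> leaves T"
            using \<open>z \<in># N\<close> N unfolding leaf_pairs_def by blast
          then show ?thesis using c t all[of p q] thr[of p q] \<open>z \<in># N\<close> Some by auto
        qed
        obtain M0 where M0: "M = add_mset (Upair i k) M0" using ik(1) by (metis mset_add)
        have "?c (Upair i k) < through v (texp (Upair i k))"
          using c[OF ik(2,3)] t[OF ik(2,3)] pik pix pky same Some by auto
        moreover have "(\<Sum>z\<in>#M0. ?c z) \<le> (\<Sum>z\<in>#M0. through v (texp z))"
          using le1 by (intro sum_mset_mono) (auto simp: M0)
        ultimately have "(\<Sum>z\<in>#M. ?c z) < (\<Sum>z\<in>#M. through v (texp z))" by (simp add: M0)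
        also have "\<dots> = (\<Sum>z\<in>#N. through v (texp z))" by (metis eq through_total_texp)
        also have "\<dots> \<le> (\<Sum>z\<in>#N. ?c z)" using le2 by (rule sum_mset_mono)
        also have "\<dots> = (\<Sum>z\<in>#M. ?c z)" by (metis eq lookup_sum_mset)
        finally show False by simp
      qed
    qed
    then obtain p q where pq: "Upair p q \<in># N" "p \<in> leaves T" "q \<in> leaves T"
      "port v p \<noteq> port v q" "port v p \<noteq> port v x" "port v q \<noteq> port v x" by blast
    \<comment> \<open>The ports of \<open>p\<close> and \<open>q\<close> differ, so at most one
      equals that of \<open>i\<close>; exchange the names if it is that of \<open>p\<close>.\<close>
    obtain p q where pq: "Upair p q \<in># N" "p \<in> leaves T" "q \<in> leaves T"
      "port v p \<noteq> port v q" "port v p \<noteq> port v x" "port v q \<noteq> port v x" "port v p \<noteq> port v i"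
    proof (cases "port v p = port v i")
      case True
      have "Upair q p \<in># N" using pq(1) Upair_commute by metis
      then show ?thesis using that[of q p] pq True by metis
    next
      case False
      then show ?thesis using that pq by blast
    qed
    have "Upair p q \<noteq> Upair i x" "Upair p q \<noteq> Upair k y"
      using pq same by auto
    then obtain K where K: "N0 = add_mset (Upair p q) K"
      using pq(1) N0 by (metis insert_noteq_member mset_add)
    have KL: "set_mset K \<subseteq> leaf_pairs" using N0L K by auto
    \<comment> \<open>The first move gives \<open>i\<close> the partner \<open>p\<close> instead of
      \<open>x\<close>. The ports of \<open>p\<close> and \<open>y\<close> differ, so a second move
      can join \<open>i\<close> with \<open>k\<close>.\<close>
    have "tetrad_congr (add_mset (Upair i x) (add_mset (Upair q p) (add_mset (Upair k y) K)))
        (add_mset (Upair i p) (add_mset (Upair x q) (add_mset (Upair k y) K)))"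
      using x y ik vleaf pix pq KL by (intro tetrad_congr_swap) auto
    moreover have "N = add_mset (Upair i x) (add_mset (Upair q p) (add_mset (Upair k y) K))"
      by (simp only: N0 K add_mset_commute Upair_commute[of q p])
    moreover have "tetrad_congr (add_mset (Upair i p) (add_mset (Upair y k) (add_mset (Upair x q) K)))
        (add_mset (Upair i k) (add_mset (Upair p y) (add_mset (Upair x q) K)))"
      using x y ik vleaf pix pky pik pq same KL by (intro tetrad_congr_swap) auto
    moreover have "add_mset (Upair i p) (add_mset (Upair x q) (add_mset (Upair k y) K)) =
        add_mset (Upair i p) (add_mset (Upair y k) (add_mset (Upair x q) K))"
      by (simp only: add_mset_commute Upair_commute[of y k])
    ultimately have "tetrad_congr N (add_mset (Upair i k) (add_mset (Upair p y) (add_mset (Upair x q) K)))"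
      using tetrad_congr_trans by simp
    then show ?thesis by (intro exI conjI) auto
  qed
qed

text \<open>The case \<open>i = k\<close>: a pair whose top is the leaf \<open>i\<close> has both
  ends below \<open>i\<close>, hence equal to it.\<close>

lemma leaf_diagonal_in:
  assumes eq: "total_texp M = total_texp N" and "set_mset N \<subseteq> leaf_pairs"
    and "Upair i i \<in># M" "i \<in> leaves T"
  shows "Upair i i \<in># N"
proof -
  have V: "i \<in> pverts T" using assms leaves_verts by auto
  then have "Poly_Mapping.lookup (texp (Upair i i)) (A_par i) \<noteq> 0"
    by (simp add: lookup_texp_A top_self)
  then obtain z where z: "z \<in># N" "Poly_Mapping.lookup (texp z) (A_par i) \<noteq> 0"
    using total_texp_pos[OF eq assms(3)] by blast
  then obtain p q where pq: "z = Upair p q" "p \<in> leaves T" "q \<in> leaves T"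
    using assms(2) unfolding leaf_pairs_def by blast
  then have "top p q = i" using z(2) by (simp add: lookup_texp_A leaves_verts)
  then have "anc i p" "anc i q" using top_anc pq leaves_verts by blast+
  then show ?thesis using leaf_anc[OF assms(4)] pq z(1) by blast
qed

section \<open>Induction on the degree and the equality of the ideals\<close>

lemma total_texp_eq_empty:
  assumes "total_texp M = 0" "set_mset M \<subseteq> leaf_pairs"
  shows "M = {#}"
proof (rule ccontr)
  assume "M \<noteq> {#}"
  then obtain z where z: "z \<in># M" by blast
  then obtain p q where pq: "z = Upair p q" "p \<in> leaves T" "q \<in> leaves T"
    using assms(2) unfolding leaf_pairs_def by blast
  then have "Poly_Mapping.lookup (texp z) (A_par (top p q)) \<noteq> 0"
    by (simp add: lookup_texp_A leaves_verts)
  then show False using total_texp_pos[of M "{#}" z] z assms(1) by auto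
qed

lemma total_texp_eq_imp_tetrad_congr:
  assumes "total_texp M = total_texp N" "set_mset M \<subseteq> leaf_pairs" "set_mset N \<subseteq> leaf_pairs"
  shows "tetrad_congr M N"
  using assms
proof (induction "size M" arbitrary: M N)
  case 0
  then have "M = {#}" "N = {#}" using total_texp_eq_empty[of N] by auto
  then show ?case using tetrad_congr_refl by simp
next
  case (Suc n)
  \<comment> \<open>Depth of the top of an unordered pair. \<open>SOME\<close> chooses an order of
    the ends, and \<open>top_commute\<close> makes the choice irrelevant.\<close>
  define d where "d = (\<lambda>z. SOME m. \<exists>p q. z = Upair p q \<and> p \<in> leaves T \<and> q \<in> leaves T \<and> m = depth (top p q))"
  have d: "d (Upair p q) = depth (top p q)" if "p \<in> leaves T" "q \<in> leaves T" for p q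
    unfolding d_def using that top_commute leaves_verts by (intro some_equality) auto
  have ne: "d ` set_mset M \<noteq> {}" using Suc by auto
  then have "Max (d ` set_mset M) \<in> d ` set_mset M" by (intro Max_in) auto
  then obtain z where z: "z \<in># M" "Max (d ` set_mset M) = d z" by blast
  have zmax: "d z' \<le> d z" if "z' \<in># M" for z'
    unfolding z(2)[symmetric] using that by (intro Max_ge) auto
  obtain i k where ik: "z = Upair i k" "i \<in> leaves T" "k \<in> leaves T"
    using z(1) Suc.prems unfolding leaf_pairs_def by blast
  have "\<exists>N'. tetrad_congr N N' \<and> Upair i k \<in># N'"
  proof (cases "i = k")
    case True
    then show ?thesis using leaf_diagonal_in[OF Suc.prems(1,3)] z ik tetrad_congr_refl[OF Suc.prems(3)] by blast
  next
    case False
    have "depth (top p q) \<le> depth (top i k)"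
      if "Upair p q \<in># M" "p \<in> leaves T" "q \<in> leaves T" for p q
      using zmax[OF that(1)] that d ik by simp
    then show ?thesis using tetrad_congr_produce_pair[OF Suc.prems _ ik(2,3) False] z(1) ik by blast
  qed
  then obtain N' where N': "tetrad_congr N N'" "Upair i k \<in># N'" by blast
  obtain M0 where M0: "M = add_mset (Upair i k) M0" using z(1) ik by (metis mset_add)
  obtain N0 where N0: "N' = add_mset (Upair i k) N0" using N' by (metis mset_add)
  \<comment> \<open>The moves preserve exponents, so the common pair \<open>Upair i k\<close> can be
    cancelled on both sides.\<close>
  have "total_texp M = total_texp N'" using tetrad_congr_total_texp[OF N'(1)] Suc.prems by simp
  then have "total_texp M0 = total_texp N0" by (simp add: M0 N0)
  moreover have "set_mset N' \<subseteq> leaf_pairs" using N' by (simp add: tetrad_congr_def)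
  ultimately have "tetrad_congr M0 N0" using Suc M0 N0 by auto
  then have "tetrad_congr M N'" using tetrad_congr_add_mset ik M0 N0 by simp
  then show ?case using N' tetrad_congr_sym tetrad_congr_trans by blast
qed

text \<open>For the hard inclusion, \<open>total_texp_eq_imp_tetrad_congr\<close> supplies the
  binomials required by \<open>monomial_subst_kernel\<close>.\<close>

lemma observed_trek_ideal_eq: "observed_trek_ideal T (leaves T) = tetrad_ideal"
proof
  show "observed_trek_ideal T (leaves T) \<subseteq> tetrad_ideal"
  proof
    fix p assume "p \<in> observed_trek_ideal T (leaves T)"
    then have p: "p \<in> carrier (poly_ring leaf_pairs)" "poly_subst (sigma_image T) p = 0"
      by (auto simp: observed_trek_ideal_iff phi_def)
    have "sigma_image T x = Poly_Mapping.single (texp x) 1" if "x \<in> leaf_pairs" for x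
      using that leaves_verts sigma_image_texp unfolding leaf_pairs_def by blast
    then show "p \<in> tetrad_ideal"
      using total_texp_eq_imp_tetrad_congr
      by (intro monomial_subst_kernel[OF _ ideal_tetrad_ideal _ p]) (auto simp: tetrad_congr_def)
  qed
qed (rule tetrad_ideal_subset)

end

theorem corollary6p5:
  fixes T :: "'v pair_pre_digraph" and r :: 'v
  assumes "rooted_directed_tree T r"
  shows "observed_trek_ideal T (leaves T) =
    Idl\<^bsub>sigma_ring (leaves T)\<^esub>
      {sigma i k * sigma j l - sigma i l * sigma k j | i j k l.
         {i, j, k, l} \<subseteq> leaves T \<and> (\<exists>c. choke_point T {i, j} {k, l} c)}"
proof -
  interpret rooted_directed_tree T r by (rule assms)
  show ?thesis
    using observed_trek_ideal_eq
    unfolding tetrad_ideal_def tetrads_def sigma_ring_leaves .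
qed

end
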